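(* For any graph $G$ and any integer $t\ge 3$, $\mathsf{mmbs}_t(G) \le \beta(\mathsf{bed}^+_t(G),t)$, where $\beta(0,t)=1$ and $\beta(x,t)=2^{t\,\beta(x-1,t)}$ for $x\ge1$ (so $\beta(1,t)=2^t$, $\beta(2,t)=2^{t2^t}$, etc., a tower of height $x$).
   Context: Fix $t\ge3$. A $t$-clique is a set of $t$ pairwise adjacent vertices. For a graph $G$, $\mathrm{opt}(G)$ is the minimum size of a set intersecting every $t$-clique of $G$. An instance of Extended $K_t$-Hitting is a pair $(G,\mathcal F)$ where $\mathcal F$ is a set of subsets $Z\subseteq V(G)$ with $1\le|Z|\le t-1$ and $G[Z]$ a clique; $\mathrm{opt}(G,\mathcal F)$ is the minimum size of a set intersecting every $t$-clique of $G$ and every $Z\in\mathcal F$. $(G,\mathcal F)$ is clean if $\mathrm{opt}(G,\mathcal F)=\mathrm{opt}(G)$. A blocking set of $(G,\mathcal F)$ is a set $\mathcal B$ of subsets $B\subseteq V(G)$ with $1\le|B|\le t-1$ and $G[B]$ a clique, such that $\mathrm{opt}(G,\mathcal F\cup\mathcal B)>\mathrm{opt}(G,\mathcal F)$. $\mathsf{mmbs}_t(G,\mathcal F)$ is the maximum size of an inclusion-wise minimal blocking set of $(G,\mathcal F)$, and $\mathsf{mmbs}_t(G)$ is the maximum of $\mathsf{mmbs}_t(G,\mathcal F)$ over all clean instances $(G,\mathcal F)$. For a connected graph $G$, a root is a nonempty $T\subseteq V(G)$ with $G[T]$ connected and $K_t$-free such that each connected component $C$ of $G-T$ has $|N(C)\cap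 T|=1$. $\mathsf{bed}^+_t(G)$ is defined recursively: $0$ if $V(G)=\emptyset$; $\mathsf{bed}^+_t(G-v)$ if $v$ lies in no $t$-clique of $G$; $\max_i\mathsf{bed}^+_t(C_i)$ if $G$ has connected components $C_1,\dots,C_c$, $c\ge2$; otherwise $1+\min_T\mathsf{bed}^+_t(G-T)$ over all roots $T$ of $G$. *)

theory Defs
  imports Main "HOL-Library.Ramsey"
begin

text \<open>
  A finite simple graph is a finite vertex set \<open>V\<close> with an edge set \<open>E \<subseteq> nsets V 2\<close> of
  two-element subsets of \<open>V\<close>. The edge set is kept fixed throughout: the induced subgraph on
  \<open>S \<subseteq> V\<close> is represented by the vertex set \<open>S\<close> together with the same \<open>E\<close>, and every notion
  below only looks at edges inside the given vertex set. Thus \<open>G - T\<close> is \<open>S - T\<close>.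
\<close>

definition t_cliques :: "'a set set \<Rightarrow> nat \<Rightarrow> 'a set \<Rightarrow> 'a set set" where
  "t_cliques E t S = {K \<in> nsets S t. clique K E}"

definition small_cliques :: "'a set set \<Rightarrow> nat \<Rightarrow> 'a set \<Rightarrow> 'a set set" where
  "small_cliques E t S = {Z. Z \<subseteq> S \<and> 1 \<le> card Z \<and> card Z \<le> t - 1 \<and> clique Z E}"

definition opt_ext :: "'a set set \<Rightarrow> nat \<Rightarrow> 'a set \<Rightarrow> 'a set set \<Rightarrow> nat" where
  "opt_ext E t S F =
     Min {card X |X. X \<subseteq> S \<and> (\<forall>K\<in>t_cliques E t S. X \<inter> K \<noteq> {}) \<and> (\<forall>Z\<in>F. X \<inter> Z \<noteq> {})}"

definition opt :: "'a set set \<Rightarrow> nat \<Rightarrow> 'a set \<Rightarrow> nat" where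
  "opt E t S = Min {card X |X. X \<subseteq> S \<and> (\<forall>K\<in>t_cliques E t S. X \<inter> K \<noteq> {})}"

definition clean :: "'a set set \<Rightarrow> nat \<Rightarrow> 'a set \<Rightarrow> 'a set set \<Rightarrow> bool" where
  "clean E t S F \<longleftrightarrow> F \<subseteq> small_cliques E t S \<and> opt_ext E t S F = opt E t S"

definition blocking_set :: "'a set set \<Rightarrow> nat \<Rightarrow> 'a set \<Rightarrow> 'a set set \<Rightarrow> 'a set set \<Rightarrow> bool" where
  "blocking_set E t S F \<B> \<longleftrightarrow>
     \<B> \<subseteq> small_cliques E t S \<and> opt_ext E t S (F \<union> \<B>) > opt_ext E t S F"

definition minimal_blocking_set ::
    "'a set set \<Rightarrow> nat \<Rightarrow> 'a set \<Rightarrow> 'a set set \<Rightarrow> 'a set set \<Rightarrow> bool" where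
  "minimal_blocking_set E t S F \<B> \<longleftrightarrow>
     blocking_set E t S F \<B> \<and> (\<forall>\<B>'. \<B>' \<subset> \<B> \<longrightarrow> \<not> blocking_set E t S F \<B>')"

text \<open>
  The inserted \<open>0\<close> only matters for instances without any blocking set (such as the empty graph),
  where the maximum is \<open>0\<close> by convention.
\<close>

definition mmbs_ext :: "'a set set \<Rightarrow> nat \<Rightarrow> 'a set \<Rightarrow> 'a set set \<Rightarrow> nat" where
  "mmbs_ext E t S F = Max (insert 0 {card \<B> |\<B>. minimal_blocking_set E t S F \<B>})"

definition mmbs :: "'a set set \<Rightarrow> nat \<Rightarrow> 'a set \<Rightarrow> nat" where
  "mmbs E t S = Max {mmbs_ext E t S F |F. clean E t S F}"

definition reach :: "'a set set \<Rightarrow> 'a set \<Rightarrow> 'a rel" where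
  "reach E S = {(u, v). u \<in> S \<and> v \<in> S \<and> {u, v} \<in> E}\<^sup>*"

definition graph_connected :: "'a set set \<Rightarrow> 'a set \<Rightarrow> bool" where
  "graph_connected E S \<longleftrightarrow> (\<forall>u\<in>S. \<forall>v\<in>S. (u, v) \<in> reach E S)"

definition conn_components :: "'a set set \<Rightarrow> 'a set \<Rightarrow> 'a set set" where
  "conn_components E S = S // reach E S"

definition nbhd :: "'a set set \<Rightarrow> 'a set \<Rightarrow> 'a set \<Rightarrow> 'a set" where
  "nbhd E S C = {u \<in> S - C. \<exists>v\<in>C. {u, v} \<in> E}"

definition bed_root :: "'a set set \<Rightarrow> nat \<Rightarrow> 'a set \<Rightarrow> 'a set \<Rightarrow> bool" where
  "bed_root E t S T \<longleftrightarrow> T \<noteq> {} \<and> T \<subseteq> S \<and> graph_connected E T \<and> t_cliques E t T = {} \<and>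
     (\<forall>C\<in>conn_components E (S - T). card (nbhd E S C \<inter> T) = 1)"

lemma equiv_reach: "equiv UNIV (reach E S)"
proof (rule equivI)
  have "sym {(u, v). u \<in> S \<and> v \<in> S \<and> {u, v} \<in> E}"
    by (auto simp: sym_def insert_commute)
  then show "sym (reach E S)"
    unfolding reach_def by (rule sym_rtrancl)
qed (auto simp: reach_def refl_on_def trans_rtrancl)

lemma reach_closed: "(u, v) \<in> reach E S \<Longrightarrow> u \<in> S \<Longrightarrow> v \<in> S"
  unfolding reach_def by (induction rule: rtrancl_induct) auto

lemma component_subset: "C \<in> conn_components E S \<Longrightarrow> C \<subseteq> S"
  by (auto simp: conn_components_def quotient_def dest: reach_closed)

lemma component_psubset:
  assumes C: "C \<in> conn_components E S" and "2 \<le> card (conn_components E S)"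
  shows "C \<subset> S"
proof -
  have "C \<noteq> S"
  proof
    assume "C = S"
    then obtain x where x: "x \<in> S" "S = reach E S `` {x}"
      using C by (auto simp: conn_components_def quotient_def)
    have "reach E S `` {y} = S" if "y \<in> S" for y
      using x that equiv_class_eq[OF equiv_reach, of x y E S] by auto
    then have "conn_components E S \<subseteq> {S}"
      by (auto simp: conn_components_def quotient_def)
    then show False
      using assms(2) card_mono[of "{S}" "conn_components E S"] by simp
  qed
  then show ?thesis
    using component_subset[OF C] by auto
qed

lemma some_free_vertex:
  assumes "\<exists>v\<in>S. \<forall>K\<in>t_cliques E t S. v \<notin> K"
  defines "w \<equiv> SOME v. v \<in> S \<and> (\<forall>K\<in>t_cliques E t S. v \<notin> K)"
  shows "w \<in> S \<and> (\<forall>K\<in>t_cliques E t S. w \<notin> K)"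
  unfolding w_def by (rule someI_ex) (use assms(1) in blast)

text \<open>
  The recursion is only meaningful for finite \<open>S\<close>; \<open>infinite S\<close> makes the function total. The
  vertex removed in the second case is arbitrary; the value does not depend on it, as shown in
  \<open>bed_remove\<close> below.
\<close>

function bed :: "'a set set \<Rightarrow> nat \<Rightarrow> 'a set \<Rightarrow> nat" where
  "bed E t S =
    (if infinite S \<or> S = {} then 0
     else if \<exists>v\<in>S. \<forall>K\<in>t_cliques E t S. v \<notin> K
       then bed E t (S - {SOME v. v \<in> S \<and> (\<forall>K\<in>t_cliques E t S. v \<notin> K)})
     else if card (conn_components E S) \<ge> 2 then Max (bed E t ` conn_components E S)
     else 1 + Min ((\<lambda>T. bed E t (S - T)) ` {T. bed_root E t S T}))"
  by pat_completeness auto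
termination
proof (relation "measure (\<lambda>(E, t, S). card S)", goal_cases)
  case (2 E t S)
  then have "(SOME v. v \<in> S \<and> (\<forall>K\<in>t_cliques E t S. v \<notin> K)) \<in> S"
    using some_free_vertex[THEN conjunct1] by simp
  with 2 show ?case
    by (simp add: card_gt_0_iff)
next
  case (3 E t S C)
  then show ?case
    by (auto intro!: psubset_card_mono dest: component_psubset)
next
  case (4 E t S T)
  then show ?case
    by (auto intro!: psubset_card_mono simp: bed_root_def)
qed auto

declare bed.simps [simp del]

lemma bed_remove:
  assumes "finite S" "v \<in> S" "\<forall>K\<in>t_cliques E t S. v \<notin> K"
  shows "bed E t S = bed E t (S - {v})"
  using assms
proof (induction "card S" arbitrary: S v rule: less_induct)
  case less
  define w where "w = (SOME v. v \<in> S \<and> (\<forall>K\<in>t_cliques E t S. v \<notin> K))"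
  have w: "w \<in> S" "\<forall>K\<in>t_cliques E t S. w \<notin> K"
    using some_free_vertex[of S E t, folded w_def] less.prems(2,3) by auto
  have bed_S: "bed E t S = bed E t (S - {w})"
    using less.prems by (subst bed.simps) (auto simp: w_def)
  show ?case
  proof (cases "v = w")
    case False
    have sub: "t_cliques E t (S - A) \<subseteq> t_cliques E t S" for A
      by (auto simp: t_cliques_def nsets_def)
    have lt: "card (S - {u}) < card S" if "u \<in> S" for u
      using that less.prems(1) by (meson card_Diff1_less)
    have "bed E t (S - {w}) = bed E t (S - {w} - {v})"
      using less.prems w False sub[of "{w}"] lt by (intro less.hyps) auto
    moreover have "bed E t (S - {v}) = bed E t (S - {v} - {w})"
      using less.prems w False sub[of "{v}"] lt by (intro less.hyps) auto
    moreover have "S - {w} - {v} = S - {v} - {w}"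
      by auto
    ultimately show ?thesis
      using bed_S by simp
  qed (use bed_S in simp)
qed

text \<open>The minimum over roots in \<open>bed\<close> is taken over a nonempty set.\<close>

lemma bed_root_singleton:
  assumes "graph_connected E S" "v \<in> S" "t \<ge> 2"
  shows "bed_root E t S {v}"
proof -
  have "card (nbhd E S C \<inter> {v}) = 1" if C: "C \<in> conn_components E (S - {v})" for C
  proof -
    obtain x where x: "x \<in> S - {v}" "C = reach E (S - {v}) `` {x}"
      using C by (auto simp: conn_components_def quotient_def)
    have "(x, v) \<in> reach E S"
      using assms x by (auto simp: graph_connected_def)
    then have "\<exists>y\<in>C. {v, y} \<in> E"
    proof (rule contrapos_pp)
      assume no: "\<not> (\<exists>y\<in>C. {v, y} \<in> E)"
      have "y \<in> C" if "(x, y) \<in> reach E S" for y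
        using that unfolding reach_def
      proof (induction rule: rtrancl_induct)
        case base
        then show ?case by (simp add: x reach_def)
      next
        case (step y z)
        have "z \<noteq> v" using step no by (auto simp: insert_commute)
        moreover have "y \<in> S - {v}" using step component_subset[OF C] by blast
        ultimately have "(y, z) \<in> {(u, w). u \<in> S - {v} \<and> w \<in> S - {v} \<and> {u, w} \<in> E}"
          using step by auto
        with step.IH show ?case
          unfolding x reach_def by (auto intro: rtrancl_into_rtrancl)
      qed
      moreover have "v \<notin> C" using component_subset[OF C] by blast
      ultimately show "(x, v) \<notin> reach E S" by blast
    qed
    moreover have "v \<notin> C" using component_subset[OF C] by blast
    ultimately have "nbhd E S C \<inter> {v} = {v}"
      using assms by (auto simp: nbhd_def)
    then show ?thesis by simp
  qed
  moreover have "K \<notin> t_cliques E t {v}" for K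
    using card_mono[of "{v}" K] assms(3) by (auto simp: t_cliques_def nsets_def)
  ultimately show ?thesis
    using assms(2) by (auto simp: bed_root_def graph_connected_def reach_def)
qed

fun beta :: "nat \<Rightarrow> nat \<Rightarrow> nat" where
  "beta 0 t = 1"
| "beta (Suc x) t = 2 ^ (t * beta x t)"

end

theory Submission
  imports Defs
begin

text \<open>
  Call a family of small cliques unhittable if no minimum hitting set of the $t$-cliques meets all of
  its members. All clean instances are governed by one number: the least \<open>n\<close> such that every
  unhittable family contains an unhittable subfamily with at most \<open>n\<close> members. This number is bounded
  for all induced subgraphs simultaneously, by induction along the recursion of \<^const>\<open>bed\<close>.

  If \<open>T\<close> is a root, label each vertex outside \<open>T\<close> by the neighbour of its component in \<open>T\<close>, and
  each vertex of \<open>T\<close> by itself. Every $t$-clique lies in one label class, so minimum hitting sets can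
  be chosen independently in the classes. A family is then unhittable for one of two reasons: it is
  unhittable inside a class \<open>H \<union> {r}\<close>, or some member \<open>K \<subseteq> T\<close> consists of roots that are all
  excluded by the family inside their classes. Excluding a root \<open>r\<close> takes few members, as the hitting
  sets containing \<open>r\<close> restrict to minimum hitting sets of \<open>H\<close>. The hitting sets avoiding \<open>r\<close> may
  exceed the minimum of \<open>H\<close> by one; branching over their traces on a small unhittable
  subfamily for \<open>H\<close> deals with them and causes the exponential blow-up.
\<close>

subsection \<open>Unhittable families\<close>

definition hits :: "'a set set \<Rightarrow> nat \<Rightarrow> 'a set \<Rightarrow> 'a set \<Rightarrow> bool" where
  "hits E t S X \<longleftrightarrow> X \<subseteq> S \<and> (\<forall>K\<in>t_cliques E t S. X \<inter> K \<noteq> {})"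

definition min_hits :: "'a set set \<Rightarrow> nat \<Rightarrow> 'a set \<Rightarrow> 'a set \<Rightarrow> bool" where
  "min_hits E t S X \<longleftrightarrow> hits E t S X \<and> card X = opt E t S"

text \<open>\<open>P\<close> is kept abstract because several classes of hitting sets are compared:
  the minimum ones, those that contain or avoid a given vertex, and those with one vertex to
  spare.\<close>

definition unhittable :: "('a set \<Rightarrow> bool) \<Rightarrow> 'a set set \<Rightarrow> bool" where
  "unhittable P \<Z> \<longleftrightarrow> (\<forall>X. P X \<longrightarrow> (\<exists>Z\<in>\<Z>. X \<inter> Z = {}))"

definition reducible :: "('a set \<Rightarrow> bool) \<Rightarrow> 'a set set \<Rightarrow> nat \<Rightarrow> bool" where
  "reducible P \<Z> n \<longleftrightarrow> (\<exists>\<W>\<subseteq>\<Z>. card \<W> \<le> n \<and> unhittable P \<W>)"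

definition crit_bound :: "'a set set \<Rightarrow> nat \<Rightarrow> 'a set \<Rightarrow> nat \<Rightarrow> bool" where
  "crit_bound E t S n \<longleftrightarrow>
     (\<forall>\<Z>\<subseteq>small_cliques E t S. unhittable (min_hits E t S) \<Z> \<longrightarrow> reducible (min_hits E t S) \<Z> n)"

text \<open>Deleting a trace \<open>A\<close>, or restricting to a label class, leads to vertex sets
  that the recursion of \<open>bed\<close> need not visit, so the induction carries all subsets at
  once.\<close>

definition hered_crit_bound :: "'a set set \<Rightarrow> nat \<Rightarrow> 'a set \<Rightarrow> nat \<Rightarrow> bool" where
  "hered_crit_bound E t S n \<longleftrightarrow> (\<forall>S'\<subseteq>S. crit_bound E t S' n)"

section \<open>Rules for unhittable and reducible families\<close>

lemma unhittableD: "unhittable P \<Z> \<Longrightarrow> P X \<Longrightarrow> \<exists>Z\<in>\<Z>. X \<inter> Z = {}"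
  by (auto simp: unhittable_def)

lemma not_unhittableE:
  assumes "\<not> unhittable P \<Z>"
  obtains X where "P X" "\<forall>Z\<in>\<Z>. X \<inter> Z \<noteq> {}"
  using assms unfolding unhittable_def by blast

lemma unhittable_mono: "unhittable P \<Z> \<Longrightarrow> \<Z> \<subseteq> \<Z>' \<Longrightarrow> unhittable P \<Z>'"
  unfolding unhittable_def by blast

lemma reducible_mono: "reducible P \<Z> n \<Longrightarrow> \<Z> \<subseteq> \<Z>' \<Longrightarrow> n \<le> n' \<Longrightarrow> reducible P \<Z>' n'"
  unfolding reducible_def by (meson order_trans)

lemma reducible_weaken:
  assumes "reducible P \<Z> n" "\<And>X. P' X \<Longrightarrow> P X"
  shows "reducible P' \<Z> n"
proof -
  obtain \<W> where "\<W> \<subseteq> \<Z>" "card \<W> \<le> n" "unhittable P \<W>"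
    using assms(1) unfolding reducible_def by blast
  moreover from this(3) assms(2) have "unhittable P' \<W>" by (simp add: unhittable_def)
  ultimately show ?thesis unfolding reducible_def by blast
qed

lemma reducible_disj:
  assumes "reducible P \<Z> m" "reducible P' \<Z> n"
  shows "reducible (\<lambda>X. P X \<or> P' X) \<Z> (m + n)"
proof -
  obtain A B where "A \<subseteq> \<Z>" "card A \<le> m" "unhittable P A" "B \<subseteq> \<Z>" "card B \<le> n" "unhittable P' B"
    using assms unfolding reducible_def by blast
  then have "A \<union> B \<subseteq> \<Z>" "card (A \<union> B) \<le> m + n"
    "unhittable P (A \<union> B)" "unhittable P' (A \<union> B)"
    using card_Un_le[of A B] unhittable_mono[of P A "A \<union> B"] unhittable_mono[of P' B "A \<union> B"]
    by simp_all
  moreover from this(3,4) have "unhittable (\<lambda>X. P X \<or> P' X) (A \<union> B)"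
    unfolding unhittable_def by blast
  ultimately show ?thesis
    unfolding reducible_def by blast
qed

lemma crit_boundD:
  "crit_bound E t S n \<Longrightarrow> \<Z> \<subseteq> small_cliques E t S \<Longrightarrow> unhittable (min_hits E t S) \<Z>
   \<Longrightarrow> reducible (min_hits E t S) \<Z> n"
  by (auto simp: crit_bound_def)

lemma hered_crit_bound_mono:
  assumes H: "hered_crit_bound E t S m" and "m \<le> n" "S' \<subseteq> S"
  shows "hered_crit_bound E t S' n"
  unfolding hered_crit_bound_def crit_bound_def
proof (intro allI impI)
  fix S'' \<Z>
  assume "S'' \<subseteq> S'" "\<Z> \<subseteq> small_cliques E t S''" "unhittable (min_hits E t S'') \<Z>"
  moreover have "crit_bound E t S'' m"
    using H calculation(1) assms(3) unfolding hered_crit_bound_def by blast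
  ultimately have "reducible (min_hits E t S'') \<Z> m" by (intro crit_boundD)
  then show "reducible (min_hits E t S'') \<Z> n" using order_refl assms(2) by (rule reducible_mono)
qed

section \<open>Hitting sets and their optimum\<close>

lemma finite_card_Collect:
  "finite S \<Longrightarrow> finite {card X |X. X \<subseteq> S \<and> P X}"
  by (rule finite_subset[of _ "card ` Pow S"]) auto

lemma opt_alt: "opt E t S = Min {card X |X. hits E t S X}"
  by (simp add: opt_def hits_def)

lemma opt_le:
  assumes "finite S" "hits E t S X"
  shows "opt E t S \<le> card X"
  unfolding opt_alt using assms finite_card_Collect[of S]
  by (intro Min_le) (auto simp: hits_def)

lemma t_cliques_subset: "K \<in> t_cliques E t S \<Longrightarrow> K \<subseteq> S"
  by (auto simp: t_cliques_def nsets_def)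

lemma t_cliques_nonempty: "t \<ge> 1 \<Longrightarrow> K \<in> t_cliques E t S \<Longrightarrow> K \<noteq> {}"
  by (auto simp: t_cliques_def nsets_def)

lemma t_cliques_mono: "S' \<subseteq> S \<Longrightarrow> t_cliques E t S' \<subseteq> t_cliques E t S"
  by (auto simp: t_cliques_def nsets_def)

lemma t_cliques_restrict: "K \<in> t_cliques E t S \<Longrightarrow> K \<subseteq> S' \<Longrightarrow> K \<in> t_cliques E t S'"
  by (auto simp: t_cliques_def nsets_def)

lemma small_cliquesD:
  assumes "Z \<in> small_cliques E t S"
  shows "Z \<subseteq> S" "Z \<noteq> {}" "card Z \<le> t - 1" "clique Z E"
  using assms by (auto simp: small_cliques_def)

lemma finite_small_cliques: "finite S \<Longrightarrow> finite (small_cliques E t S)"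
  by (rule finite_subset[of _ "Pow S"]) (auto simp: small_cliques_def)

lemma hits_self:
  assumes "t \<ge> 1"
  shows "hits E t S S"
proof -
  have "S \<inter> K \<noteq> {}" if "K \<in> t_cliques E t S" for K
    using t_cliques_subset[OF that] t_cliques_nonempty[OF assms that] by blast
  then show ?thesis by (simp add: hits_def)
qed

lemma ex_min_hits:
  assumes "finite S" "t \<ge> 1"
  shows "\<exists>X. min_hits E t S X"
proof -
  have "finite {card X |X. hits E t S X}"
    using finite_card_Collect[OF assms(1)] by (simp add: hits_def)
  moreover have "{card X |X. hits E t S X} \<noteq> {}"
    using hits_self[OF assms(2)] by blast
  ultimately have "opt E t S \<in> {card X |X. hits E t S X}"
    unfolding opt_alt by (rule Min_in)
  then show ?thesis
    by (auto simp: min_hits_def)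
qed

lemma min_hitsI:
  assumes "finite S" "hits E t S X" "card X \<le> opt E t S"
  shows "min_hits E t S X"
  using opt_le[OF assms(1,2)] assms(2,3) by (simp add: min_hits_def)

lemma min_hitsD:
  assumes "min_hits E t S X"
  shows "hits E t S X" "X \<subseteq> S" "card X = opt E t S"
  using assms by (auto simp: min_hits_def hits_def)

lemma min_hits_finite: "min_hits E t S X \<Longrightarrow> finite S \<Longrightarrow> finite X"
  by (rule finite_subset[OF min_hitsD(2)])

lemma hits_Diff:
  assumes "hits E t S X"
  shows "hits E t (S - A) (X - A)"
proof -
  have "(X - A) \<inter> K \<noteq> {}" if K: "K \<in> t_cliques E t (S - A)" for K
  proof -
    have "K \<in> t_cliques E t S" using K t_cliques_mono[of "S - A" S] by blast
    then have "X \<inter> K \<noteq> {}" using assms by (simp add: hits_def)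
    then show ?thesis using t_cliques_subset[OF K] by blast
  qed
  then show ?thesis using assms unfolding hits_def by blast
qed

lemma hits_Un:
  assumes "hits E t (S - A) X" "A \<subseteq> S"
  shows "hits E t S (X \<union> A)"
proof -
  have "(X \<union> A) \<inter> K \<noteq> {}" if K: "K \<in> t_cliques E t S" for K
  proof (cases "A \<inter> K = {}")
    case True
    then have "K \<in> t_cliques E t (S - A)"
      using K t_cliques_subset[OF K] by (auto intro: t_cliques_restrict)
    then show ?thesis using assms by (auto simp: hits_def)
  qed auto
  then show ?thesis using assms by (auto simp: hits_def)
qed

text \<open>One preimage is kept for each member outside \<open>\<K>\<close>, so pulling back along
  \<open>f\<close> does not increase the count. It is used with \<open>f\<close> deleting a vertex
  and \<open>\<K>\<close> holding any members that come from t-cliques rather than from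
  \<open>\<Z>\<close>.\<close>

lemma finite_family_lift:
  assumes "\<W> \<subseteq> \<K> \<union> f ` \<Z>" "finite \<W>"
  obtains \<W>' where "\<W>' \<subseteq> \<Z>" "card \<W>' \<le> card \<W>" "\<W> \<subseteq> \<K> \<union> f ` \<W>'"
proof -
  have "\<W> - \<K> \<subseteq> f ` \<Z>" using assms by auto
  then obtain \<W>' where W': "\<W>' \<subseteq> \<Z>" "inj_on f \<W>'" "\<W> - \<K> = f ` \<W>'"
    by (auto simp: subset_image_inj)
  have "card \<W>' = card (\<W> - \<K>)" using W' by (simp add: card_image)
  also have "\<dots> \<le> card \<W>" using assms by (simp add: card_mono)
  finally show thesis using W' by (intro that) auto
qed

subsection \<open>Hitting sets with one extra vertex\<close>

text \<open>
  Take a small unhittable subfamily \<open>\<M>\<close> for the minimum hitting sets. If a hitting set of size one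
  above the minimum hits \<open>\<M>\<close> and meets \<open>\<Union>\<M>\<close> exactly in \<open>A\<close>, then \<open>A\<close> already hits \<open>\<M>\<close>,
  so that the rest must be a \<^emph>\<open>minimum\<close> hitting set of the graph without \<open>A\<close>.
\<close>

lemma reducible_opt_plus_one:
  assumes fin: "finite R" and t: "t \<ge> 1" and H: "hered_crit_bound E t R m"
    and Q: "\<Q> \<subseteq> small_cliques E t R"
    and un: "unhittable (\<lambda>X. hits E t R X \<and> card X \<le> opt E t R + 1) \<Q>"
  shows "reducible (\<lambda>X. hits E t R X \<and> card X \<le> opt E t R + 1) \<Q> (m + 2 ^ ((t - 1) * m) * m)"
proof -
  have "unhittable (min_hits E t R) \<Q>"
    using un by (auto simp: unhittable_def min_hits_def)
  then have "reducible (min_hits E t R) \<Q> m"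
    using H Q by (auto simp: hered_crit_bound_def intro: crit_boundD)
  then obtain \<M> where M: "\<M> \<subseteq> \<Q>" "card \<M> \<le> m" "unhittable (min_hits E t R) \<M>"
    unfolding reducible_def by blast
  define U where "U = \<Union>\<M>"
  have UR: "U \<subseteq> R" using M(1) Q by (auto simp: U_def small_cliques_def)
  then have finU: "finite U" using fin by (rule finite_subset)
  have "card U \<le> (\<Sum>Z\<in>\<M>. card Z)" unfolding U_def by (rule card_Union_le_sum_card)
  also have "\<dots> \<le> (\<Sum>Z\<in>\<M>. t - 1)"
    using M(1) Q by (intro sum_mono) (auto simp: small_cliques_def)
  also have "\<dots> \<le> (t - 1) * m" using M(2) by simp
  finally have cardU: "card U \<le> (t - 1) * m" .
  \<comment> \<open>Otherwise \<open>A\<close> and an optimum of \<open>R - A\<close> would form a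
    minimum hitting set of \<open>R\<close> that meets every member of \<open>\<M>\<close>.\<close>
  have more: "opt E t R + 1 \<le> opt E t (R - A) + card A" if "A \<subseteq> U" "\<forall>Z\<in>\<M>. A \<inter> Z \<noteq> {}" for A
  proof (rule ccontr)
    assume less: "\<not> opt E t R + 1 \<le> opt E t (R - A) + card A"
    obtain Y where Y: "min_hits E t (R - A) Y"
      using ex_min_hits[of "R - A" t E] fin t by auto
    have "hits E t R (Y \<union> A)"
      using min_hitsD(1)[OF Y] that(1) UR by (intro hits_Un) auto
    moreover have "card (Y \<union> A) \<le> opt E t R"
      using card_Un_le[of Y A] min_hitsD(3)[OF Y] less by simp
    ultimately have "min_hits E t R (Y \<union> A)" using fin by (intro min_hitsI)
    then show False using unhittableD[OF M(3)] that(2) by blast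
  qed
  \<comment> \<open>The guard lets one family be chosen for every trace \<open>A\<close>: if
    \<open>A\<close> leaves too small a budget for \<open>R - A\<close>, the empty family serves as
    a default. Otherwise only the members of \<open>\<Q>\<close> missed by \<open>A\<close> matter,
    and they survive in \<open>R - A\<close>.\<close>
  have "\<exists>\<N>. \<N> \<subseteq> {Z \<in> \<Q>. A \<inter> Z = {}} \<and> card \<N> \<le> m \<and>
    ((\<forall>Z\<in>\<M>. A \<inter> Z \<noteq> {}) \<and> opt E t (R - A) + card A \<le> opt E t R + 1 \<longrightarrow>
     unhittable (min_hits E t (R - A)) \<N>)" if A: "A \<subseteq> U" for A
  proof (cases "opt E t (R - A) + card A \<le> opt E t R + 1")
    case True
    define \<Q>' where "\<Q>' = {Z \<in> \<Q>. A \<inter> Z = {}}"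
    have "unhittable (min_hits E t (R - A)) \<Q>'"
      unfolding unhittable_def
    proof (intro allI impI)
      fix Y assume Y: "min_hits E t (R - A) Y"
      have "hits E t R (Y \<union> A)"
        using min_hitsD(1)[OF Y] A UR by (intro hits_Un) auto
      moreover have "card (Y \<union> A) \<le> opt E t R + 1"
        using card_Un_le[of Y A] min_hitsD(3)[OF Y] True by simp
      ultimately obtain Z where "Z \<in> \<Q>" "(Y \<union> A) \<inter> Z = {}"
        using unhittableD[OF un] by blast
      then show "\<exists>Z\<in>\<Q>'. Y \<inter> Z = {}" by (auto simp: \<Q>'_def)
    qed
    moreover have "\<Q>' \<subseteq> small_cliques E t (R - A)"
      using Q by (auto simp: \<Q>'_def small_cliques_def)
    ultimately have "reducible (min_hits E t (R - A)) \<Q>' m"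
      using H by (auto simp: hered_crit_bound_def intro: crit_boundD)
    then show ?thesis
      unfolding reducible_def \<Q>'_def by blast
  qed (auto intro: exI[of _ "{}"])
  then have "\<forall>A\<in>Pow U. \<exists>\<N>. \<N> \<subseteq> {Z \<in> \<Q>. A \<inter> Z = {}} \<and> card \<N> \<le> m \<and>
    ((\<forall>Z\<in>\<M>. A \<inter> Z \<noteq> {}) \<and> opt E t (R - A) + card A \<le> opt E t R + 1 \<longrightarrow>
     unhittable (min_hits E t (R - A)) \<N>)" by blast
  from bchoice[OF this] obtain \<N> where
    N0: "\<forall>A\<in>Pow U. \<N> A \<subseteq> {Z \<in> \<Q>. A \<inter> Z = {}} \<and> card (\<N> A) \<le> m \<and>
    ((\<forall>Z\<in>\<M>. A \<inter> Z \<noteq> {}) \<and> opt E t (R - A) + card A \<le> opt E t R + 1 \<longrightarrow>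
     unhittable (min_hits E t (R - A)) (\<N> A))" ..
  have N: "\<N> A \<subseteq> {Z \<in> \<Q>. A \<inter> Z = {}}" "card (\<N> A) \<le> m"
    "\<forall>Z\<in>\<M>. A \<inter> Z \<noteq> {} \<Longrightarrow> opt E t (R - A) + card A \<le> opt E t R + 1 \<Longrightarrow>
      unhittable (min_hits E t (R - A)) (\<N> A)" if "A \<subseteq> U" for A
    using bspec[OF N0, of A] that by simp_all
  define \<W> where "\<W> = \<M> \<union> (\<Union>A\<in>Pow U. \<N> A)"
  have "card (\<Union>A\<in>Pow U. \<N> A) \<le> (\<Sum>A\<in>Pow U. card (\<N> A))"
    using finU by (intro card_UN_le) auto
  also have "\<dots> \<le> (\<Sum>A\<in>Pow U. m)" using N(2) by (intro sum_mono) auto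
  also have "\<dots> = 2 ^ card U * m" using finU by (simp add: card_Pow)
  also have "\<dots> \<le> 2 ^ ((t - 1) * m) * m"
    using cardU by (intro mult_le_mono1 power_increasing) auto
  finally have "card \<W> \<le> m + 2 ^ ((t - 1) * m) * m"
    using card_Un_le[of \<M> "\<Union>A\<in>Pow U. \<N> A"] M(2) by (simp add: \<W>_def)
  moreover have "\<N> A \<subseteq> \<Q>" if "A \<subseteq> U" for A using N(1)[OF that] by blast
  then have "\<W> \<subseteq> \<Q>" unfolding \<W>_def using M(1) by blast
  moreover have "unhittable (\<lambda>X. hits E t R X \<and> card X \<le> opt E t R + 1) \<W>"
    unfolding unhittable_def
  proof (intro allI impI)
    fix X assume X: "hits E t R X \<and> card X \<le> opt E t R + 1"
    show "\<exists>Z\<in>\<W>. X \<inter> Z = {}"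
    proof (rule ccontr)
      assume "\<not> (\<exists>Z\<in>\<W>. X \<inter> Z = {})"
      then have hitW: "X \<inter> Z \<noteq> {}" if "Z \<in> \<W>" for Z using that by blast
      define A where "A = X \<inter> U"
      have AU: "A \<subseteq> U" by (simp add: A_def)
      have hitM: "\<forall>Z\<in>\<M>. A \<inter> Z \<noteq> {}"
        using hitW by (fastforce simp: \<W>_def A_def U_def)
      have finX: "finite X" using X fin finite_subset by (auto simp: hits_def)
      have cX: "card X = card (X - A) + card A"
        using finX card_Diff_subset[of A X] card_mono[of X A] by (auto simp: A_def)
      have hX: "hits E t (R - A) (X - A)" using X by (intro hits_Diff) auto
      then have "opt E t (R - A) \<le> card (X - A)" using fin by (intro opt_le) auto
      \<comment> \<open>\<open>more\<close> is the lower bound that leaves \<open>X - A\<close> no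
        vertex to spare beyond \<open>opt E t (R - A)\<close>.\<close>
      then have eq: "opt E t (R - A) + card A \<le> opt E t R + 1" "card (X - A) \<le> opt E t (R - A)"
        using more[OF AU hitM] X cX by auto
      have "min_hits E t (R - A) (X - A)"
        using hX eq(2) fin by (intro min_hitsI) auto
      then obtain Z where Z: "Z \<in> \<N> A" "(X - A) \<inter> Z = {}"
        using unhittableD[OF N(3)[OF AU hitM eq(1)]] by blast
      then have "X \<inter> Z = {}" using N(1)[OF AU] by blast
      then show False using hitW[of Z] Z(1) AU by (auto simp: \<W>_def)
    qed
  qed
  ultimately show ?thesis unfolding reducible_def by blast
qed

subsection \<open>Adding one vertex\<close>

lemma opt_Diff_le: "finite S \<Longrightarrow> t \<ge> 1 \<Longrightarrow> opt E t (S - A) \<le> opt E t S"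
proof -
  assume fin: "finite S" and "t \<ge> 1"
  then obtain X where X: "min_hits E t S X" using ex_min_hits by blast
  have "opt E t (S - A) \<le> card (X - A)"
    using fin min_hitsD(1)[OF X] by (intro opt_le hits_Diff) auto
  also have "\<dots> \<le> card X"
    using min_hitsD(2)[OF X] fin by (intro card_mono) (auto intro: finite_subset)
  finally show ?thesis using min_hitsD(3)[OF X] by simp
qed

lemma opt_le_Suc_opt_Diff:
  assumes "finite S" "t \<ge> 1" "r \<in> S"
  shows "opt E t S \<le> opt E t (S - {r}) + 1"
proof -
  obtain X where X: "min_hits E t (S - {r}) X" using ex_min_hits assms(1,2) by blast
  have "opt E t S \<le> card (X \<union> {r})"
    using assms min_hitsD(1)[OF X] by (intro opt_le hits_Un) auto
  also have "\<dots> \<le> opt E t (S - {r}) + 1"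
    using card_Un_le[of X "{r}"] min_hitsD(3)[OF X] by simp
  finally show ?thesis .
qed

lemma reducible_with_vertex:
  assumes fin: "finite S" and t: "t \<ge> 1" and r: "r \<in> S" and Q: "crit_bound E t (S - {r}) m"
    and Z: "\<Z> \<subseteq> small_cliques E t S"
    and un: "unhittable (\<lambda>X. min_hits E t S X \<and> r \<in> X) \<Z>"
  shows "reducible (\<lambda>X. min_hits E t S X \<and> r \<in> X) \<Z> m"
proof (cases "opt E t (S - {r}) + 1 \<le> opt E t S")
  case True
  define \<Z>' where "\<Z>' = {Z \<in> \<Z>. r \<notin> Z}"
  have "unhittable (min_hits E t (S - {r})) \<Z>'"
    unfolding unhittable_def
  proof (intro allI impI)
    fix Y assume Y: "min_hits E t (S - {r}) Y"
    have "min_hits E t S (Y \<union> {r})"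
      using Y True fin r card_Un_le[of Y "{r}"]
      by (intro min_hitsI hits_Un) (auto dest: min_hitsD)
    then obtain Z where "Z \<in> \<Z>" "(Y \<union> {r}) \<inter> Z = {}"
      using unhittableD[OF un] by blast
    then show "\<exists>Z\<in>\<Z>'. Y \<inter> Z = {}" by (auto simp: \<Z>'_def)
  qed
  moreover have "\<Z>' \<subseteq> small_cliques E t (S - {r})"
    using Z by (auto simp: \<Z>'_def small_cliques_def)
  ultimately have "reducible (min_hits E t (S - {r})) \<Z>' m"
    using Q by (intro crit_boundD)
  then obtain \<W> where W: "\<W> \<subseteq> \<Z>'" "card \<W> \<le> m" "unhittable (min_hits E t (S - {r})) \<W>"
    unfolding reducible_def by blast
  have "unhittable (\<lambda>X. min_hits E t S X \<and> r \<in> X) \<W>"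
    unfolding unhittable_def
  proof (intro allI impI)
    fix X assume X: "min_hits E t S X \<and> r \<in> X"
    have "card X = card (X - {r}) + 1"
      using X min_hits_finite[OF _ fin] card.remove[of X r] unfolding Suc_eq_plus1 by blast
    then have "card (X - {r}) \<le> opt E t (S - {r})"
      using X min_hitsD(3)[of E t S X] opt_le_Suc_opt_Diff[OF fin t r, of E] by linarith
    then have "min_hits E t (S - {r}) (X - {r})"
      using X fin by (intro min_hitsI hits_Diff) (auto dest: min_hitsD)
    then obtain Z where "Z \<in> \<W>" "(X - {r}) \<inter> Z = {}"
      using unhittableD[OF W(3)] by blast
    then show "\<exists>Z\<in>\<W>. X \<inter> Z = {}" using W(1) by (intro bexI[of _ Z]) (auto simp: \<Z>'_def)
  qed
  then show ?thesis using W unfolding reducible_def \<Z>'_def by blast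
next
  case False
  have "\<not> (min_hits E t S X \<and> r \<in> X)" for X
  proof
    assume X: "min_hits E t S X \<and> r \<in> X"
    then have "finite X" using min_hits_finite[OF _ fin] by blast
    then have "card X = card (X - {r}) + 1"
      using X card.remove[of X r] unfolding Suc_eq_plus1 by blast
    moreover have "opt E t (S - {r}) \<le> card (X - {r})"
      using X fin by (intro opt_le hits_Diff) (auto dest: min_hitsD)
    ultimately show False using X False by (auto dest: min_hitsD)
  qed
  then show ?thesis
    by (auto simp: reducible_def unhittable_def intro!: exI[of _ "{}"])
qed

lemma clique_minus: "clique K E \<Longrightarrow> clique (K - A) E"
  by (auto simp: clique_def)

text \<open>The singleton \<open>{r}\<close> is excluded since deleting \<open>r\<close> would leave
  the empty set, which is not a small clique.\<close>

lemma small_cliques_delete: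
  assumes fin: "finite S" and Z: "\<Z> \<subseteq> small_cliques E t S" and "{r} \<notin> \<Z>"
  shows "(\<lambda>Z. Z - {r}) ` \<Z> \<subseteq> small_cliques E t (S - {r})"
proof safe
  fix Y assume Y: "Y \<in> \<Z>"
  then have Y': "Y \<noteq> {}" "Y \<subseteq> S" "card Y \<le> t - 1" "clique Y E"
    using small_cliquesD[OF subsetD[OF Z Y]] by simp_all
  moreover have "finite Y" using Y'(2) fin by (rule finite_subset)
  moreover have "Y - {r} \<noteq> {}"
    using Y assms(3) Y'(1) by (metis Diff_eq_empty_iff subset_singletonD)
  moreover have "card (Y - {r}) \<le> card Y" using \<open>finite Y\<close> by (intro card_mono) auto
  ultimately show "Y - {r} \<in> small_cliques E t (S - {r})"
    by (auto simp: small_cliques_def Suc_le_eq card_gt_0_iff intro: clique_minus)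
qed

text \<open>Once \<open>r\<close> is forbidden, deleting it from the t-cliques through it makes them
  small cliques that must be hit in \<open>S - {r}\<close>. The budget \<open>opt E t S\<close>
  exceeds the optimum of \<open>S - {r}\<close> by at most one, so either the bound \<open>m\<close>
  applies directly or the branching over traces does.\<close>

lemma reducible_without_vertex:
  assumes fin: "finite S" and t: "t \<ge> 2" and m: "m \<ge> 1" and r: "r \<in> S"
    and H: "hered_crit_bound E t (S - {r}) m"
    and Z: "\<Z> \<subseteq> small_cliques E t S"
    and un: "unhittable (\<lambda>X. min_hits E t S X \<and> r \<notin> X) \<Z>"
  shows "reducible (\<lambda>X. min_hits E t S X \<and> r \<notin> X) \<Z> (m + 2 ^ ((t - 1) * m) * m)"
proof (cases "{r} \<in> \<Z>")
  case True
  \<comment> \<open>No set avoiding \<open>r\<close> meets \<open>{r}\<close>, so this one member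
    suffices; \<open>m \<ge> 1\<close> leaves room for it.\<close>
  then show ?thesis
    using m unfolding reducible_def by (intro exI[of _ "{{r}}"]) (auto simp: unhittable_def)
next
  case False
  let ?R = "S - {r}"
  let ?P = "\<lambda>X. hits E t ?R X \<and> card X \<le> opt E t S"
  define \<K> where "\<K> = (\<lambda>K. K - {r}) ` {K \<in> t_cliques E t S. r \<in> K}"
  define \<Q> where "\<Q> = \<K> \<union> (\<lambda>Z. Z - {r}) ` \<Z>"
  have "\<K> \<subseteq> small_cliques E t ?R"
    using t by (auto simp: \<K>_def small_cliques_def t_cliques_def nsets_def intro: clique_minus)
  moreover have "(\<lambda>Z. Z - {r}) ` \<Z> \<subseteq> small_cliques E t ?R"
    using fin Z False by (rule small_cliques_delete)
  ultimately have Q: "\<Q> \<subseteq> small_cliques E t ?R" by (simp add: \<Q>_def)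
  have unQ: "unhittable ?P \<Q>"
    unfolding unhittable_def
  proof (intro allI impI, rule ccontr)
    fix X assume X: "?P X" and "\<not> (\<exists>Z\<in>\<Q>. X \<inter> Z = {})"
    then have hit: "X \<inter> Z \<noteq> {}" if "Z \<in> \<Q>" for Z using that by blast
    have "X \<inter> K \<noteq> {}" if K: "K \<in> t_cliques E t S" for K
    proof (cases "r \<in> K")
      case True
      then have "K - {r} \<in> \<Q>" using K by (auto simp: \<Q>_def \<K>_def)
      then show ?thesis using hit by blast
    next
      case False
      then have "K \<in> t_cliques E t ?R"
        using K t_cliques_subset[OF K] by (auto intro: t_cliques_restrict)
      then show ?thesis using X by (auto simp: hits_def)
    qed
    then have "min_hits E t S X" "r \<notin> X"
      using X fin by (auto intro!: min_hitsI simp: hits_def)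
    then obtain Y where "Y \<in> \<Z>" "X \<inter> Y = {}" using unhittableD[OF un] by blast
    then show False using hit[of "Y - {r}"] by (auto simp: \<Q>_def)
  qed
  have "opt E t S = opt E t ?R \<or> opt E t S = opt E t ?R + 1"
    using opt_Diff_le[of S t E "{r}"] opt_le_Suc_opt_Diff[of S t r E] fin t r by auto
  then have "reducible ?P \<Q> (m + 2 ^ ((t - 1) * m) * m)"
  proof
    assume eq: "opt E t S = opt E t ?R"
    then have P: "?P = min_hits E t ?R"
      using fin by (auto simp: fun_eq_iff intro!: min_hitsI dest: min_hitsD)
    have "reducible ?P \<Q> m"
      using H unQ Q unfolding P by (intro crit_boundD) (auto simp: hered_crit_bound_def)
    then show ?thesis by (rule reducible_mono) auto
  next
    assume "opt E t S = opt E t ?R + 1"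
    then show ?thesis
      using reducible_opt_plus_one[of ?R t E m \<Q>] fin t H Q unQ by simp
  qed
  then obtain \<W> where W: "\<W> \<subseteq> \<Q>" "card \<W> \<le> m + 2 ^ ((t - 1) * m) * m" "unhittable ?P \<W>"
    unfolding reducible_def by blast
  have "finite \<W>" using W(1) Q fin finite_small_cliques[of ?R] by (meson finite_Diff finite_subset)
  then obtain \<W>' where W': "\<W>' \<subseteq> \<Z>" "card \<W>' \<le> card \<W>" "\<W> \<subseteq> \<K> \<union> (\<lambda>Z. Z - {r}) ` \<W>'"
    using finite_family_lift[of \<W> \<K> "\<lambda>Z. Z - {r}" \<Z>] W(1) unfolding \<Q>_def by blast
  have "unhittable (\<lambda>X. min_hits E t S X \<and> r \<notin> X) \<W>'"
    unfolding unhittable_def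
  proof (intro allI impI)
    fix X assume X: "min_hits E t S X \<and> r \<notin> X"
    then have "?P X" using hits_Diff[of E t S X "{r}"] by (auto dest: min_hitsD)
    then obtain Y where Y: "Y \<in> \<W>" "X \<inter> Y = {}" using unhittableD[OF W(3)] by blast
    \<comment> \<open>Members of \<open>\<K>\<close> cannot be the missed ones: \<open>X\<close>
      meets the original t-clique and avoids \<open>r\<close>.\<close>
    have "Y \<notin> \<K>"
    proof
      assume "Y \<in> \<K>"
      then obtain K where "K \<in> t_cliques E t S" "Y = K - {r}" by (auto simp: \<K>_def)
      moreover have "X \<inter> K \<noteq> {}" using X calculation(1) by (auto simp: min_hits_def hits_def)
      ultimately show False using X Y(2) by blast
    qed
    then obtain Y' where "Y' \<in> \<W>'" "Y = Y' - {r}" using W'(3) Y(1) by blast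
    then show "\<exists>Z\<in>\<W>'. X \<inter> Z = {}" using X Y(2) by blast
  qed
  then show ?thesis using W' W(2) unfolding reducible_def by (meson order_trans)
qed

lemma two_mult_le_two_power: "2 * m \<le> (2::nat) ^ m"
proof (induction m)
  case (Suc m)
  then show ?case by (cases "m = 0") auto
qed simp

text \<open>The first inequality adds the costs of the two cases \<open>r \<in> X\<close> and
  \<open>r \<notin> X\<close>; the second counts one member inside the root together with at most
  \<open>t - 1\<close> families of size at most \<open>m\<close>. Both fit into one step of
  \<open>beta\<close>.\<close>

lemma exponential_bounds:
  assumes "t \<ge> 2" "m \<ge> 1"
  shows "m + (m + 2 ^ ((t - 1) * m) * m) \<le> (2::nat) ^ (t * m)" "1 + (t - 1) * m \<le> (2::nat) ^ (t * m)"
proof -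
  define a where "a = (2::nat) ^ ((t - 1) * m)"
  have a: "2 \<le> a" using assms power_increasing[of 1 "(t - 1) * m" "2::nat"] by (simp add: a_def)
  have "m + (m + a * m) = m * 2 + m * a" by simp
  also have "\<dots> \<le> m * a + m * a" by (intro add_right_mono mult_le_mono2 a)
  also have "\<dots> = 2 * m * a" by simp
  \<comment> \<open>The linear factor costs \<open>2 ^ m\<close>, which raises the exponent from
    \<open>(t - 1) * m\<close> to \<open>t * m\<close>.\<close>
  also have "\<dots> \<le> 2 ^ m * a" by (intro mult_le_mono1 two_mult_le_two_power)
  also have "\<dots> = 2 ^ (m + (t - 1) * m)" by (simp add: a_def power_add)
  also have "m + (t - 1) * m = t * m" using assms by (cases t) auto
  finally show "m + (m + 2 ^ ((t - 1) * m) * m) \<le> (2::nat) ^ (t * m)" by (simp add: a_def)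
  have "1 + (t - 1) * m \<le> t * m" using assms by (cases t) (auto simp: algebra_simps)
  also have "\<dots> \<le> 2 ^ (t * m)" by (simp add: less_imp_le)
  finally show "1 + (t - 1) * m \<le> (2::nat) ^ (t * m)" .
qed

text \<open>Each minimum hitting set either contains \<open>r\<close> or avoids it, and the costs of
  the two cases add. \<open>r\<close> may lie outside \<open>S\<close>, because a label class can be
  free of root vertices.\<close>

lemma crit_bound_insert_vertex:
  assumes fin: "finite S" and t: "t \<ge> 2" and m: "m \<ge> 1" and H: "hered_crit_bound E t (S - {r}) m"
  shows "crit_bound E t S (2 ^ (t * m))"
proof (cases "r \<in> S")
  case False
  have "m \<le> m + (m + 2 ^ ((t - 1) * m) * m)" by simp
  also have "\<dots> \<le> 2 ^ (t * m)" using exponential_bounds(1) t m by blast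
  finally have "hered_crit_bound E t S (2 ^ (t * m))"
    using hered_crit_bound_mono[OF H _ order_refl] False by simp
  then show ?thesis by (auto simp: hered_crit_bound_def)
next
  case True
  show ?thesis
    unfolding crit_bound_def
  proof (intro allI impI)
    fix \<Z> assume Z: "\<Z> \<subseteq> small_cliques E t S" and un: "unhittable (min_hits E t S) \<Z>"
    have "reducible (\<lambda>X. min_hits E t S X \<and> r \<in> X) \<Z> m"
      using fin t True H Z un
      by (intro reducible_with_vertex) (auto simp: hered_crit_bound_def unhittable_def)
    moreover have "reducible (\<lambda>X. min_hits E t S X \<and> r \<notin> X) \<Z> (m + 2 ^ ((t - 1) * m) * m)"
      using fin t m True H Z un
      by (intro reducible_without_vertex) (auto simp: unhittable_def)
    ultimately have "reducible (min_hits E t S) \<Z> (m + (m + 2 ^ ((t - 1) * m) * m))"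
      by (rule reducible_weaken[OF reducible_disj]) auto
    then show "reducible (min_hits E t S) \<Z> (2 ^ (t * m))"
      using exponential_bounds(1)[OF t m] reducible_mono by blast
  qed
qed


subsection \<open>Gluing along label classes\<close>

text \<open>By exchange: replacing \<open>X \<inter> A\<close> by an optimum of
  \<open>S \<inter> A\<close> still hits everything, since no t-clique straddles the boundary of
  \<open>A\<close>. Hence the trace of \<open>X\<close> cannot be larger than that optimum.\<close>

lemma min_hits_part:
  assumes fin: "finite S" and t: "t \<ge> 1" and X: "min_hits E t S X"
    and sep: "\<And>K. K \<in> t_cliques E t S \<Longrightarrow> K \<subseteq> A \<or> K \<inter> A = {}"
  shows "min_hits E t (S \<inter> A) (X \<inter> A)"
proof -
  obtain Y where Y: "min_hits E t (S \<inter> A) Y" using ex_min_hits fin t by blast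
  have finX: "finite X" using X fin by (rule min_hits_finite)
  have "X - A \<union> Y \<subseteq> S" using min_hitsD(2)[OF X] min_hitsD(2)[OF Y] by blast
  moreover have "(X - A \<union> Y) \<inter> K \<noteq> {}" if K: "K \<in> t_cliques E t S" for K
  proof -
    consider "K \<subseteq> A" | "K \<inter> A = {}" using sep[OF K] by blast
    then show ?thesis
    proof cases
      case 1
      then have "K \<in> t_cliques E t (S \<inter> A)"
        using K t_cliques_subset[OF K] by (auto intro: t_cliques_restrict)
      then show ?thesis using min_hitsD(1)[OF Y] unfolding hits_def by blast
    next
      case 2
      have "X \<inter> K \<noteq> {}" using K min_hitsD(1)[OF X] unfolding hits_def by blast
      then show ?thesis using 2 by blast
    qed
  qed
  ultimately have "opt E t S \<le> card (X - A \<union> Y)"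
    using fin by (intro opt_le) (auto simp: hits_def)
  also have "\<dots> \<le> card (X - A) + opt E t (S \<inter> A)"
    using card_Un_le[of "X - A" Y] min_hitsD(3)[OF Y] by simp
  finally have "card X \<le> card (X - A) + opt E t (S \<inter> A)" using min_hitsD(3)[OF X] by simp
  moreover have "card X = card (X - A) + card (X \<inter> A)"
    using finX card_Diff_subset_Int[of X A] card_mono[of X "X \<inter> A"] by simp
  moreover have "hits E t (S \<inter> A) (X \<inter> A)"
    using hits_Diff[OF min_hitsD(1)[OF X], of "- A"] by (simp add: Diff_Compl)
  ultimately show ?thesis using fin by (intro min_hitsI) auto
qed

lemma fibre_cases:
  assumes "\<exists>i. K \<subseteq> p -` {i}"
  shows "K \<subseteq> p -` {j} \<or> K \<inter> p -` {j} = {}"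
proof -
  obtain i where "K \<subseteq> p -` {i}" using assms ..
  then show ?thesis by (cases "i = j") auto
qed

lemma card_eq_sum_fibres:
  assumes "finite S" "X \<subseteq> S"
  shows "card X = (\<Sum>i\<in>p ` S. card (X \<inter> p -` {i}))"
proof -
  have "card (\<Union>i\<in>p ` S. X \<inter> p -` {i}) = (\<Sum>i\<in>p ` S. card (X \<inter> p -` {i}))"
    using assms(1) finite_subset[OF assms(2,1)] by (intro card_UN_disjoint) auto
  moreover have "(\<Union>i\<in>p ` S. X \<inter> p -` {i}) = X" using assms(2) by auto
  ultimately show ?thesis by simp
qed

text \<open>The traces of a global minimum are minimum in each class, so independently chosen
  \<open>Y i\<close> have the same sizes and their union has optimal total size.\<close>

lemma min_hits_UN_fibres:
  assumes fin: "finite S" and t: "t \<ge> 1"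
    and sep: "\<And>K. K \<in> t_cliques E t S \<Longrightarrow> \<exists>i. K \<subseteq> p -` {i}"
    and Y: "\<And>i. i \<in> p ` S \<Longrightarrow> min_hits E t (S \<inter> p -` {i}) (Y i)"
  shows "min_hits E t S (\<Union>i\<in>p ` S. Y i)"
proof -
  obtain X where X: "min_hits E t S X" using ex_min_hits fin t by blast
  have "(\<Union>i\<in>p ` S. Y i) \<inter> K \<noteq> {}" if K: "K \<in> t_cliques E t S" for K
  proof -
    obtain i where i: "K \<subseteq> p -` {i}" using sep[OF K] by blast
    have "K \<subseteq> S" "K \<noteq> {}" using K t t_cliques_subset t_cliques_nonempty by blast+
    then have "i \<in> p ` S" "K \<in> t_cliques E t (S \<inter> p -` {i})"
      using i K by (blast, auto intro: t_cliques_restrict)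
    then show ?thesis using min_hitsD(1)[OF Y[of i]] unfolding hits_def by blast
  qed
  moreover have "(\<Union>i\<in>p ` S. Y i) \<subseteq> S" using min_hitsD(2)[OF Y] by blast
  ultimately have "hits E t S (\<Union>i\<in>p ` S. Y i)" by (simp add: hits_def)
  moreover have "card (\<Union>i\<in>p ` S. Y i) \<le> opt E t S"
  proof -
    have "card (\<Union>i\<in>p ` S. Y i) \<le> (\<Sum>i\<in>p ` S. card (Y i))" using fin by (intro card_UN_le) auto
    also have "\<dots> = (\<Sum>i\<in>p ` S. card (X \<inter> p -` {i}))"
    proof (rule sum.cong[OF refl])
      fix i assume i: "i \<in> p ` S"
      have "min_hits E t (S \<inter> p -` {i}) (X \<inter> p -` {i})"
        using fin t X by (rule min_hits_part) (intro fibre_cases sep)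
      then show "card (Y i) = card (X \<inter> p -` {i})"
        using min_hitsD(3) Y[OF i] by metis
    qed
    also have "\<dots> = card X"
      using fin min_hitsD(2)[OF X] by (rule card_eq_sum_fibres[symmetric])
    finally show ?thesis using min_hitsD(3)[OF X] by simp
  qed
  ultimately show ?thesis using fin by (intro min_hitsI)
qed

lemma reducible_part:
  assumes fin: "finite S" and t: "t \<ge> 1"
    and sep: "\<And>K. K \<in> t_cliques E t S \<Longrightarrow> K \<subseteq> A \<or> K \<inter> A = {}"
    and red: "reducible (min_hits E t (S \<inter> A)) {Z \<in> \<Z>. Z \<subseteq> A} n"
  shows "reducible (min_hits E t S) \<Z> n"
proof -
  obtain \<W> where W: "\<W> \<subseteq> {Z \<in> \<Z>. Z \<subseteq> A}" "card \<W> \<le> n" "unhittable (min_hits E t (S \<inter> A)) \<W>"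
    using red unfolding reducible_def by blast
  have "unhittable (min_hits E t S) \<W>"
    unfolding unhittable_def
  proof (intro allI impI)
    fix X assume "min_hits E t S X"
    then have "min_hits E t (S \<inter> A) (X \<inter> A)" by (rule min_hits_part[OF fin t _ sep])
    then obtain Z where "Z \<in> \<W>" "X \<inter> A \<inter> Z = {}" using unhittableD[OF W(3)] by blast
    then show "\<exists>Z\<in>\<W>. X \<inter> Z = {}" using W(1) by blast
  qed
  then show ?thesis using W unfolding reducible_def by blast
qed

text \<open>Only edges inside \<open>T\<close> may change the label, so a vertex of \<open>K\<close>
  outside \<open>T\<close> forces its label on the whole clique.\<close>

lemma clique_in_fibre:
  assumes "clique K E" "K \<subseteq> S" "\<not> K \<subseteq> T"
    and edge: "\<And>u v. u \<in> S \<Longrightarrow> v \<in> S \<Longrightarrow> {u, v} \<in> E \<Longrightarrow> u \<in> T \<and> v \<in> T \<or> p u = p v"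
  shows "\<exists>i. K \<subseteq> p -` {i}"
proof -
  obtain u where u: "u \<in> K" "u \<notin> T" using assms(3) by blast
  have "p v = p u" if "v \<in> K" for v
  proof (cases "v = u")
    case False
    then have "{u, v} \<in> E" using assms(1) u(1) that by (auto simp: clique_def)
    then show ?thesis using edge[of u v] u that assms(2) by (metis subsetD)
  qed simp
  then show ?thesis by blast
qed

text \<open>All edges respect the labels, so every small clique lies in one class. If each class
  could hit its own members, the union of the local solutions would hit the whole family; hence a
  single class is to blame and the bound does not grow.\<close>

lemma crit_bound_fibres:
  assumes fin: "finite S" and t: "t \<ge> 1"
    and edge: "\<And>u v. u \<in> S \<Longrightarrow> v \<in> S \<Longrightarrow> {u, v} \<in> E \<Longrightarrow> p u = p v"
    and bound: "\<And>i. crit_bound E t (S \<inter> p -` {i}) n"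
  shows "crit_bound E t S n"
  unfolding crit_bound_def
proof (intro allI impI)
  fix \<Z> assume Z: "\<Z> \<subseteq> small_cliques E t S" and un: "unhittable (min_hits E t S) \<Z>"
  have fibre: "\<exists>i. K \<subseteq> p -` {i}" if "clique K E" "K \<subseteq> S" "K \<noteq> {}" for K
    using that clique_in_fibre[of K E S "{}" p] edge by blast
  have sep: "\<exists>i. K \<subseteq> p -` {i}" if "K \<in> t_cliques E t S" for K
    using that t t_cliques_nonempty[OF t that] t_cliques_subset[OF that] fibre
    by (simp add: t_cliques_def)
  define part where "part i = {Z \<in> \<Z>. Z \<subseteq> p -` {i}}" for i
  have "\<exists>i. unhittable (min_hits E t (S \<inter> p -` {i})) (part i)"
  proof (rule ccontr)
    assume "\<not> ?thesis"
    then have "\<exists>Y. min_hits E t (S \<inter> p -` {i}) Y \<and> (\<forall>Z\<in>part i. Y \<inter> Z \<noteq> {})" for i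
      using not_unhittableE[of "min_hits E t (S \<inter> p -` {i})" "part i"] by metis
    then have "\<forall>i. \<exists>Y. min_hits E t (S \<inter> p -` {i}) Y \<and> (\<forall>Z\<in>part i. Y \<inter> Z \<noteq> {})" ..
    from choice[OF this] obtain Y where
      Y: "\<forall>i. min_hits E t (S \<inter> p -` {i}) (Y i) \<and> (\<forall>Z\<in>part i. Y i \<inter> Z \<noteq> {})" ..
    have "min_hits E t S (\<Union>i\<in>p ` S. Y i)"
      using fin t sep by (rule min_hits_UN_fibres) (use Y in auto)
    then obtain K where K: "K \<in> \<Z>" "(\<Union>i\<in>p ` S. Y i) \<inter> K = {}"
      using unhittableD[OF un] by blast
    have "K \<subseteq> S" "K \<noteq> {}" "clique K E"
      using small_cliquesD[OF subsetD[OF Z K(1)]] by simp_all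
    then obtain i where i: "K \<subseteq> p -` {i}" using fibre by blast
    then have "K \<in> part i" "i \<in> p ` S" using K(1) \<open>K \<subseteq> S\<close> \<open>K \<noteq> {}\<close> by (auto simp: part_def)
    then have "Y i \<inter> K \<noteq> {}" "Y i \<subseteq> (\<Union>i\<in>p ` S. Y i)" using Y by auto
    then show False using K(2) by blast
  qed
  then obtain i where i: "unhittable (min_hits E t (S \<inter> p -` {i})) (part i)" ..
  have "part i \<subseteq> small_cliques E t (S \<inter> p -` {i})"
    using Z by (auto simp: part_def small_cliques_def)
  then have "reducible (min_hits E t (S \<inter> p -` {i})) (part i) n"
    using bound[of i] i by (intro crit_boundD)
  then show "reducible (min_hits E t S) \<Z> n"
    unfolding part_def by (rule reducible_part[OF fin t, rotated]) (intro fibre_cases sep)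
qed

text \<open>The shape of the root is encoded in the label map \<open>p\<close>. Members not
  contained in \<open>T\<close> stay in one class, while a member inside \<open>T\<close> may spread
  over several classes and couples their choices.\<close>

lemma crit_bound_root:
  assumes fin: "finite S" and t: "t \<ge> 2" and m: "m \<ge> 1"
    and T: "T \<subseteq> S" "t_cliques E t T = {}" "inj_on p T"
    and edge: "\<And>u v. u \<in> S \<Longrightarrow> v \<in> S \<Longrightarrow> {u, v} \<in> E \<Longrightarrow> u \<in> T \<and> v \<in> T \<or> p u = p v"
    and H: "hered_crit_bound E t (S - T) m"
  shows "crit_bound E t S (2 ^ (t * m))"
  unfolding crit_bound_def
proof (intro allI impI)
  fix \<Z> assume Z: "\<Z> \<subseteq> small_cliques E t S" and un: "unhittable (min_hits E t S) \<Z>"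
  have t1: "t \<ge> 1" using t by simp
  define part where "part i = {Z \<in> \<Z>. Z \<subseteq> p -` {i}}" for i
  have part: "part i \<subseteq> small_cliques E t (S \<inter> p -` {i})" for i
    using Z by (auto simp: part_def small_cliques_def)
  have fibre: "\<exists>i. K \<subseteq> p -` {i}" if "clique K E" "K \<subseteq> S" "\<not> K \<subseteq> T" for K
    using that edge by (rule clique_in_fibre)
  have sep: "\<exists>i. K \<subseteq> p -` {i}" if K: "K \<in> t_cliques E t S" for K
  proof -
    have "\<not> K \<subseteq> T" using K T(2) t_cliques_restrict by blast
    then show ?thesis using K t_cliques_subset[OF K] fibre by (simp add: t_cliques_def)
  qed
  then have sep': "K \<subseteq> p -` {i} \<or> K \<inter> p -` {i} = {}" if "K \<in> t_cliques E t S" for K i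
    using that by (intro fibre_cases)
  have root: "r' = r" if "r \<in> T" "r' \<in> T" "p r' = p r" for r r'
    using that T(3) by (auto dest: inj_onD)
  show "reducible (min_hits E t S) \<Z> (2 ^ (t * m))"
  proof (cases "\<exists>i. unhittable (min_hits E t (S \<inter> p -` {i})) (part i)")
    case True
    then obtain i where i: "unhittable (min_hits E t (S \<inter> p -` {i})) (part i)" ..
    \<comment> \<open>\<open>T\<close> has at most one vertex with label \<open>i\<close>; if there
      is none, any \<open>r\<close> will do.\<close>
    obtain r where "S \<inter> p -` {i} - {r} \<subseteq> S - T" using root by blast
    then have "hered_crit_bound E t (S \<inter> p -` {i} - {r}) m"
      by (rule hered_crit_bound_mono[OF H order_refl])
    then have "crit_bound E t (S \<inter> p -` {i}) (2 ^ (t * m))"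
      using fin t m by (intro crit_bound_insert_vertex) auto
    then have "reducible (min_hits E t (S \<inter> p -` {i})) (part i) (2 ^ (t * m))"
      using part i by (intro crit_boundD)
    then show ?thesis
      unfolding part_def by (rule reducible_part[OF fin t1 sep', rotated])
  next
    case False
    define good where
      "good i Y \<longleftrightarrow> min_hits E t (S \<inter> p -` {i}) Y \<and> (\<forall>Z\<in>part i. Y \<inter> Z \<noteq> {})" for i Y
    \<comment> \<open>Each local solution is chosen to contain the root of its class whenever some
      solution hitting \<open>part i\<close> does; a root missing from \<open>Y i\<close> is
      therefore excluded by \<open>part i\<close>.\<close>
    have "\<exists>Y. good i Y \<and> (\<forall>r\<in>T. p r = i \<and> (\<exists>Y'. good i Y' \<and> r \<in> Y') \<longrightarrow> r \<in> Y)" for i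
    proof (cases "\<exists>r\<in>T. p r = i \<and> (\<exists>Y'. good i Y' \<and> r \<in> Y')")
      case True
      then show ?thesis using root by blast
    next
      case no_root: False
      have "\<exists>Y. good i Y"
        using False not_unhittableE[of "min_hits E t (S \<inter> p -` {i})" "part i"]
        unfolding good_def by metis
      then show ?thesis using no_root by blast
    qed
    then have "\<forall>i. \<exists>Y. good i Y \<and> (\<forall>r\<in>T. p r = i \<and> (\<exists>Y'. good i Y' \<and> r \<in> Y') \<longrightarrow> r \<in> Y)" ..
    from choice[OF this] obtain Y where
      "\<forall>i. good i (Y i) \<and> (\<forall>r\<in>T. p r = i \<and> (\<exists>Y'. good i Y' \<and> r \<in> Y') \<longrightarrow> r \<in> Y i)" ..
    then have Y: "good i (Y i)" "\<And>r Y'. r \<in> T \<Longrightarrow> p r = i \<Longrightarrow> good i Y' \<Longrightarrow> r \<in> Y' \<Longrightarrow> r \<in> Y i" for i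
      by blast+
    have "min_hits E t S (\<Union>i\<in>p ` S. Y i)"
      using fin t1 sep by (rule min_hits_UN_fibres) (use Y(1) in \<open>auto simp: good_def\<close>)
    then obtain K where K: "K \<in> \<Z>" "(\<Union>i\<in>p ` S. Y i) \<inter> K = {}"
      using unhittableD[OF un] by blast
    have KS: "K \<subseteq> S" "K \<noteq> {}" "clique K E" "card K \<le> t - 1"
      using small_cliquesD[OF subsetD[OF Z K(1)]] by simp_all
    have KT: "K \<subseteq> T"
    proof (rule ccontr)
      assume "\<not> K \<subseteq> T"
      then obtain i where i: "K \<subseteq> p -` {i}" using fibre KS by blast
      then have "K \<in> part i" "i \<in> p ` S" using K(1) KS by (auto simp: part_def)
      then show False using K(2) Y(1)[of i] unfolding good_def by blast
    qed
    have finK: "finite K" using KS(1) fin by (rule finite_subset)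
    \<comment> \<open>\<open>K\<close> avoids every \<open>Y i\<close>, so each of its roots is
      excluded in its own class, and at most \<open>m\<close> members suffice for that.\<close>
    have "\<exists>\<W>\<subseteq>part (p r). card \<W> \<le> m \<and>
        unhittable (\<lambda>Y. min_hits E t (S \<inter> p -` {p r}) Y \<and> r \<in> Y) \<W>" if r: "r \<in> K" for r
    proof -
      have "r \<notin> Y (p r)" using K(2) r KS(1) by blast
      then have "unhittable (\<lambda>Y. min_hits E t (S \<inter> p -` {p r}) Y \<and> r \<in> Y) (part (p r))"
        using Y(2)[of r "p r"] r KT unfolding unhittable_def good_def by blast
      moreover have "S \<inter> p -` {p r} - {r} \<subseteq> S - T" using root[of r] r KT by blast
      then have "crit_bound E t (S \<inter> p -` {p r} - {r}) m"
        using H by (simp add: hered_crit_bound_def)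
      ultimately have "reducible (\<lambda>Y. min_hits E t (S \<inter> p -` {p r}) Y \<and> r \<in> Y) (part (p r)) m"
        using part fin t1 r KS(1) by (intro reducible_with_vertex) auto
      then show ?thesis unfolding reducible_def .
    qed
    then have "\<forall>r\<in>K. \<exists>\<W>. \<W> \<subseteq> part (p r) \<and> card \<W> \<le> m \<and>
        unhittable (\<lambda>Y. min_hits E t (S \<inter> p -` {p r}) Y \<and> r \<in> Y) \<W>" by blast
    from bchoice[OF this] obtain \<W> where
      W: "\<forall>r\<in>K. \<W> r \<subseteq> part (p r) \<and> card (\<W> r) \<le> m \<and>
        unhittable (\<lambda>Y. min_hits E t (S \<inter> p -` {p r}) Y \<and> r \<in> Y) (\<W> r)" ..
    \<comment> \<open>A minimum hitting set that meets \<open>K\<close> contains some root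
      \<open>r \<in> K\<close>, and its trace on the class of \<open>r\<close> then misses a member
      of \<open>\<W> r\<close>.\<close>
    define \<W>' where "\<W>' = insert K (\<Union>r\<in>K. \<W> r)"
    have "card (\<Union>r\<in>K. \<W> r) \<le> (\<Sum>r\<in>K. card (\<W> r))" using finK by (intro card_UN_le)
    also have "\<dots> \<le> (\<Sum>r\<in>K. m)" using W by (intro sum_mono) auto
    also have "\<dots> \<le> (t - 1) * m" using KS(4) by simp
    finally have "card \<W>' \<le> 1 + (t - 1) * m"
      using card_insert_le_m1[of "1 + (t - 1) * m" "\<Union>r\<in>K. \<W> r" K] by (simp add: \<W>'_def)
    also have "\<dots> \<le> 2 ^ (t * m)" using exponential_bounds(2) t m .
    finally have "card \<W>' \<le> 2 ^ (t * m)" .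
    moreover have "\<W>' \<subseteq> \<Z>"
      using W K(1) unfolding \<W>'_def part_def by blast
    moreover have "unhittable (min_hits E t S) \<W>'"
      unfolding unhittable_def
    proof (intro allI impI)
      fix X assume X: "min_hits E t S X"
      show "\<exists>Z\<in>\<W>'. X \<inter> Z = {}"
      proof (cases "X \<inter> K = {}")
        case False
        then obtain r where r: "r \<in> X" "r \<in> K" by blast
        have "min_hits E t (S \<inter> p -` {p r}) (X \<inter> p -` {p r})"
          using fin t1 X sep' by (rule min_hits_part)
        moreover have "r \<in> X \<inter> p -` {p r}" using r(1) by simp
        ultimately obtain Z where Z: "Z \<in> \<W> r" "X \<inter> p -` {p r} \<inter> Z = {}"
          using unhittableD[of _ "\<W> r" "X \<inter> p -` {p r}"] bspec[OF W r(2)] by blast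
        then have "Z \<subseteq> p -` {p r}" using bspec[OF W r(2)] unfolding part_def by blast
        then have "X \<inter> Z = {}" using Z(2) by blast
        then show ?thesis using Z(1) r(2) unfolding \<W>'_def by blast
      qed (simp add: \<W>'_def)
    qed
    ultimately show ?thesis unfolding reducible_def by blast
  qed
qed


subsection \<open>Induction along the elimination distance\<close>

text \<open>A minimum hitting set never contains \<open>v\<close>, because dropping it would leave a
  smaller hitting set. So \<open>S\<close> and \<open>S - {v}\<close> have the same minimum hitting
  sets and the bound is kept; \<open>n \<ge> 1\<close> pays for the member \<open>{v}\<close>, which
  no minimum hitting set meets.\<close>

lemma crit_bound_free_vertex:
  assumes fin: "finite S" and t: "t \<ge> 1" and n: "n \<ge> 1"
    and free: "\<And>K. K \<in> t_cliques E t S \<Longrightarrow> v \<notin> K"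
    and bound: "crit_bound E t (S - {v}) n"
  shows "crit_bound E t S n"
  unfolding crit_bound_def
proof (intro allI impI)
  fix \<Z> assume Z: "\<Z> \<subseteq> small_cliques E t S" and un: "unhittable (min_hits E t S) \<Z>"
  have eq: "t_cliques E t (S - {v}) = t_cliques E t S"
  proof
    show "t_cliques E t S \<subseteq> t_cliques E t (S - {v})"
    proof
      fix K assume K: "K \<in> t_cliques E t S"
      then have "K \<subseteq> S - {v}" using free[OF K] t_cliques_subset[OF K] by blast
      with K show "K \<in> t_cliques E t (S - {v})" by (rule t_cliques_restrict)
    qed
  qed (rule t_cliques_mono, blast)
  have hitsI: "hits E t S X" if "hits E t (S - {v}) X" for X
    using that unfolding hits_def eq by blast
  have hitsD: "hits E t (S - {v}) (X - {v})" if "hits E t S X" for X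
    using that by (rule hits_Diff)
  have lift: "min_hits E t S X" if X: "min_hits E t (S - {v}) X" for X
    using fin hitsI[OF min_hitsD(1)[OF X]]
    by (rule min_hitsI) (use min_hitsD(3)[OF X] opt_Diff_le[OF fin t] in simp)
  have avoid: "v \<notin> X" if X: "min_hits E t S X" for X
  proof
    assume "v \<in> X"
    then have "card (X - {v}) < card X" using min_hits_finite[OF X fin] by (rule card_Diff1_less[rotated])
    moreover have "opt E t S \<le> card (X - {v})"
      using fin by (rule opt_le) (rule hitsI[OF hitsD[OF min_hitsD(1)[OF X]]])
    ultimately show False using min_hitsD(3)[OF X] by simp
  qed
  have restrict: "min_hits E t (S - {v}) X" if X: "min_hits E t S X" for X
  proof -
    obtain X' where X': "min_hits E t (S - {v}) X'" using ex_min_hits[of "S - {v}" t E] fin t by auto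
    have "opt E t S = opt E t (S - {v})"
      using min_hitsD(3)[OF lift[OF X']] min_hitsD(3)[OF X'] by simp
    moreover have "hits E t (S - {v}) X" using hitsD[OF min_hitsD(1)[OF X]] avoid[OF X] by simp
    ultimately show ?thesis using min_hitsD(3)[OF X] by (simp add: min_hits_def)
  qed
  show "reducible (min_hits E t S) \<Z> n"
  proof (cases "{v} \<in> \<Z>")
    case True
    then show ?thesis
      using n avoid unfolding reducible_def by (intro exI[of _ "{{v}}"]) (auto simp: unhittable_def)
  next
    case False
    define \<Z>' where "\<Z>' = (\<lambda>Z. Z - {v}) ` \<Z>"
    have sub: "\<Z>' \<subseteq> small_cliques E t (S - {v})"
      unfolding \<Z>'_def using fin Z False by (rule small_cliques_delete)
    moreover have "unhittable (min_hits E t (S - {v})) \<Z>'"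
      unfolding unhittable_def
    proof (intro allI impI)
      fix X assume X: "min_hits E t (S - {v}) X"
      obtain Z where "Z \<in> \<Z>" "X \<inter> Z = {}" using unhittableD[OF un lift[OF X]] ..
      then show "\<exists>Z\<in>\<Z>'. X \<inter> Z = {}"
        unfolding \<Z>'_def by (intro bexI[of _ "Z - {v}"]) auto
    qed
    ultimately have "reducible (min_hits E t (S - {v})) \<Z>' n" using bound by (intro crit_boundD)
    then obtain \<W> where W: "\<W> \<subseteq> \<Z>'" "card \<W> \<le> n" "unhittable (min_hits E t (S - {v})) \<W>"
      unfolding reducible_def by blast
    have "finite \<W>"
      using W(1) sub finite_small_cliques[of "S - {v}" E t] fin by (meson finite_Diff finite_subset)
    then obtain \<W>' where W': "\<W>' \<subseteq> \<Z>" "card \<W>' \<le> card \<W>" "\<W> \<subseteq> {} \<union> (\<lambda>Z. Z - {v}) ` \<W>'"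
      using finite_family_lift[of \<W> "{}" "\<lambda>Z. Z - {v}" \<Z>] W(1) unfolding \<Z>'_def by auto
    have "unhittable (min_hits E t S) \<W>'"
      unfolding unhittable_def
    proof (intro allI impI)
      fix X assume X: "min_hits E t S X"
      obtain Y where "Y \<in> \<W>" "X \<inter> Y = {}" using unhittableD[OF W(3) restrict[OF X]] ..
      moreover obtain Z where "Z \<in> \<W>'" "Y = Z - {v}" using W'(3) calculation(1) by blast
      ultimately show "\<exists>Z\<in>\<W>'. X \<inter> Z = {}" using avoid[OF X] by blast
    qed
    then show ?thesis using W' W(2) unfolding reducible_def by (meson order_trans)
  qed
qed

section \<open>Bounds for all vertex subsets\<close>

lemma hered_crit_bound_free_vertex:
  assumes "finite S" "t \<ge> 1" "n \<ge> 1"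
    and free: "\<And>K. K \<in> t_cliques E t S \<Longrightarrow> v \<notin> K"
    and bound: "hered_crit_bound E t (S - {v}) n"
  shows "hered_crit_bound E t S n"
  unfolding hered_crit_bound_def
proof (intro allI impI)
  fix S' assume S': "S' \<subseteq> S"
  show "crit_bound E t S' n"
  proof (rule crit_bound_free_vertex[OF finite_subset[OF S' assms(1)] assms(2,3)])
    show "v \<notin> K" if "K \<in> t_cliques E t S'" for K
      using free that t_cliques_mono[OF S'] by blast
    show "crit_bound E t (S' - {v}) n"
      using bound S' unfolding hered_crit_bound_def by (meson Diff_mono order_refl)
  qed
qed

lemma hered_crit_bound_fibres:
  assumes "finite S" "t \<ge> 1"
    and edge: "\<And>u v. u \<in> S \<Longrightarrow> v \<in> S \<Longrightarrow> {u, v} \<in> E \<Longrightarrow> p u = p v"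
    and bound: "\<And>i. hered_crit_bound E t (S \<inter> p -` {i}) n"
  shows "hered_crit_bound E t S n"
  unfolding hered_crit_bound_def
proof (intro allI impI)
  fix S' assume S': "S' \<subseteq> S"
  show "crit_bound E t S' n"
  proof (rule crit_bound_fibres[OF finite_subset[OF S' assms(1)] assms(2)])
    show "p u = p v" if "u \<in> S'" "v \<in> S'" "{u, v} \<in> E" for u v
      using edge that S' by blast
    show "crit_bound E t (S' \<inter> p -` {i}) n" for i
      using bound[of i] S' unfolding hered_crit_bound_def by (meson Int_mono order_refl)
  qed
qed

text \<open>For \<open>S' \<subseteq> S\<close> the set \<open>T \<inter> S'\<close> need not be a
  root of \<open>S'\<close>, but \<open>p\<close> restricted to \<open>S'\<close> keeps the
  properties that \<open>crit_bound_root\<close> asks for.\<close>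

lemma hered_crit_bound_root:
  assumes "finite S" "t \<ge> 2" "m \<ge> 1"
    and T: "T \<subseteq> S" "t_cliques E t T = {}" "inj_on p T"
    and edge: "\<And>u v. u \<in> S \<Longrightarrow> v \<in> S \<Longrightarrow> {u, v} \<in> E \<Longrightarrow> u \<in> T \<and> v \<in> T \<or> p u = p v"
    and H: "hered_crit_bound E t (S - T) m"
  shows "hered_crit_bound E t S (2 ^ (t * m))"
  unfolding hered_crit_bound_def
proof (intro allI impI)
  fix S' assume S': "S' \<subseteq> S"
  show "crit_bound E t S' (2 ^ (t * m))"
  proof (rule crit_bound_root[OF finite_subset[OF S' assms(1)] assms(2,3)])
    show "T \<inter> S' \<subseteq> S'" by blast
    show "t_cliques E t (T \<inter> S') = {}" using T(2) t_cliques_mono[of "T \<inter> S'" T E t] by blast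
    show "inj_on p (T \<inter> S')" using T(3) by (rule inj_on_subset) blast
    show "u \<in> T \<inter> S' \<and> v \<in> T \<inter> S' \<or> p u = p v" if "u \<in> S'" "v \<in> S'" "{u, v} \<in> E" for u v
      using edge[of u v] that S' by blast
    show "hered_crit_bound E t (S' - T \<inter> S') m"
      using H order_refl by (rule hered_crit_bound_mono) (use S' in blast)
  qed
qed

lemma crit_bound_empty: "t \<ge> 1 \<Longrightarrow> crit_bound E t {} n"
  unfolding crit_bound_def
proof (intro allI impI)
  fix \<Z> assume t: "t \<ge> 1" and "\<Z> \<subseteq> small_cliques E t {}" "unhittable (min_hits E t {}) \<Z>"
  moreover have "small_cliques E t {} = {}" by (auto simp: small_cliques_def)
  moreover obtain X where "min_hits E t {} X" using ex_min_hits[of "{}" t E] t by auto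
  ultimately show "reducible (min_hits E t {}) \<Z> n" by (auto dest: unhittableD)
qed

section \<open>Towers, labels and components\<close>

lemma beta_ge_1: "1 \<le> beta x t"
  by (cases x) auto

lemma beta_mono: "t \<ge> 1 \<Longrightarrow> x \<le> y \<Longrightarrow> beta x t \<le> beta y t"
proof (rule lift_Suc_mono_le[of "\<lambda>x. beta x t"])
  fix x assume "t \<ge> 1"
  then have "beta x t \<le> t * beta x t" by simp
  also have "\<dots> \<le> beta (Suc x) t" by (simp add: less_imp_le)
  finally show "beta x t \<le> beta (Suc x) t" .
qed

lemma reach_edge: "u \<in> S \<Longrightarrow> v \<in> S \<Longrightarrow> {u, v} \<in> E \<Longrightarrow> reach E S `` {u} = reach E S `` {v}"
  by (rule equiv_class_eq[OF equiv_reach]) (auto simp: reach_def)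

text \<open>The root condition gives each component of \<open>S - T\<close> exactly one neighbour in
  \<open>T\<close>, and this is the label of all its vertices. Root vertices label themselves, which
  yields injectivity.\<close>

lemma ex_root_map:
  fixes S :: "'a set"
  assumes "bed_root E t S T"
  shows "\<exists>p :: 'a \<Rightarrow> 'a. inj_on p T \<and>
    (\<forall>u\<in>S. \<forall>v\<in>S. {u, v} \<in> E \<longrightarrow> u \<in> T \<and> v \<in> T \<or> p u = p v)"
proof -
  define C where "C u = reach E (S - T) `` {u}" for u
  define p where "p u = (if u \<in> T then u else the_elem (nbhd E S (C u) \<inter> T))" for u
  have edge: "p u = v" if "u \<in> S - T" "v \<in> T" "{u, v} \<in> E" for u v
  proof -
    have "C u \<in> conn_components E (S - T)"
      using that(1) by (auto simp: C_def conn_components_def quotient_def)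
    moreover from component_subset[OF this] have "v \<notin> C u" using that(2) by blast
    moreover have "u \<in> C u" by (simp add: C_def reach_def)
    moreover have "v \<in> S" using assms that(2) unfolding bed_root_def by blast
    ultimately have "v \<in> nbhd E S (C u) \<inter> T" "card (nbhd E S (C u) \<inter> T) = 1"
      using assms that(2,3) by (auto simp: bed_root_def nbhd_def insert_commute)
    then have "nbhd E S (C u) \<inter> T = {v}" by (metis card_1_singletonE singletonD)
    then show ?thesis using that by (simp add: p_def)
  qed
  have "u \<in> T \<and> v \<in> T \<or> p u = p v" if uv: "u \<in> S" "v \<in> S" "{u, v} \<in> E" for u v
  proof -
    consider "u \<in> T" "v \<in> T" | "u \<in> T" "v \<notin> T" | "u \<notin> T" "v \<in> T" | "u \<notin> T" "v \<notin> T" by blast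
    then show ?thesis
    proof cases
      case 2
      then show ?thesis using edge[of v u] uv by (simp add: insert_commute p_def)
    next
      case 3
      then show ?thesis using edge[of u v] uv by (simp add: p_def)
    next
      case 4
      then show ?thesis using reach_edge[of u "S - T" v E] uv by (simp add: p_def C_def)
    qed simp
  qed
  moreover have "inj_on p T" by (auto simp: inj_on_def p_def)
  ultimately show ?thesis by blast
qed

lemma finite_conn_components: "finite S \<Longrightarrow> finite (conn_components E S)"
  by (rule finite_subset[of _ "Pow S"]) (simp_all add: component_subset subsetI)

lemma connected_if_few_components:
  assumes "finite S" "card (conn_components E S) \<le> 1"
  shows "graph_connected E S"
  unfolding graph_connected_def
proof (intro ballI)
  fix u v assume uv: "u \<in> S" "v \<in> S"
  have "reach E S `` {u} = reach E S `` {v}"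
    using assms(2) uv finite_conn_components[OF assms(1)] by (intro card_le_Suc0_iff_eq[THEN iffD1, rule_format])
      (auto simp: conn_components_def quotient_def)
  from eq_equiv_class[OF this equiv_reach] show "(u, v) \<in> reach E S" by simp
qed

text \<open>Strong induction on the number of vertices along the recursion of \<open>bed\<close>:
  removing a free vertex or splitting into components keeps the bound, and removing a root costs one
  exponentiation.\<close>

lemma hered_crit_bound_beta:
  fixes S :: "'a set"
  assumes "finite S" "t \<ge> 2"
  shows "hered_crit_bound E t S (beta (bed E t S) t)"
  using assms(1)
proof (induction "card S" arbitrary: S rule: less_induct)
  case less
  note IH = less.hyps and fin = less.prems
  have t: "t \<ge> 1" using assms(2) by simp
  consider (empty) "S = {}"
    | (free) v where "S \<noteq> {}" "v \<in> S" "\<forall>K\<in>t_cliques E t S. v \<notin> K"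
    | (components) "S \<noteq> {}" "\<not> (\<exists>v\<in>S. \<forall>K\<in>t_cliques E t S. v \<notin> K)" "card (conn_components E S) \<ge> 2"
    | (connected) "S \<noteq> {}" "\<not> (\<exists>v\<in>S. \<forall>K\<in>t_cliques E t S. v \<notin> K)" "card (conn_components E S) < 2"
    using linorder_not_le[of 2 "card (conn_components E S)"] by blast
  then show ?case
  proof cases
    case empty
    then show ?thesis using crit_bound_empty[OF t] by (auto simp: hered_crit_bound_def)
  next
    case free
    have "hered_crit_bound E t (S - {v}) (beta (bed E t (S - {v})) t)"
      using fin free(2) by (intro IH psubset_card_mono) auto
    \<comment> \<open>The recursion of \<open>bed\<close> removes a vertex picked by
      \<open>SOME\<close>; \<open>bed_remove\<close> allows the given \<open>v\<close>
      instead.\<close>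
    then show ?thesis
      using hered_crit_bound_free_vertex[OF fin t beta_ge_1, of E v] free bed_remove[OF fin free(2,3)]
      by simp
  next
    case components
    have bed: "bed E t S = Max (bed E t ` conn_components E S)"
      by (subst bed.simps) (use components fin in auto)
    have finC: "finite (conn_components E S)" using fin by (rule finite_conn_components)
    show ?thesis
    \<comment> \<open>Each vertex is labelled by its own component, so every nonempty class lies in
      a component.\<close>
    proof (rule hered_crit_bound_fibres[OF fin t, of _ "\<lambda>u. reach E S `` {u}"])
      show "reach E S `` {u} = reach E S `` {v}" if "u \<in> S" "v \<in> S" "{u, v} \<in> E" for u v
        using that by (rule reach_edge)
      fix C
      let ?A = "S \<inter> (\<lambda>u. reach E S `` {u}) -` {C}"
      show "hered_crit_bound E t ?A (beta (bed E t S) t)"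
      proof (cases "?A = {}")
        case True
        then show ?thesis using crit_bound_empty[OF t] by (auto simp: hered_crit_bound_def)
      next
        case False
        then have C: "C \<in> conn_components E S" by (auto simp: conn_components_def quotient_def)
        have CS: "C \<subset> S" using C components(3) by (rule component_psubset)
        have "?A \<subseteq> C" by (auto simp: reach_def)
        have "hered_crit_bound E t C (beta (bed E t C) t)"
          using CS fin by (intro IH psubset_card_mono) (auto intro: finite_subset)
        moreover have "beta (bed E t C) t \<le> beta (bed E t S) t"
          unfolding bed using t C finC by (intro beta_mono Max_ge) auto
        ultimately show ?thesis using \<open>?A \<subseteq> C\<close> by (rule hered_crit_bound_mono)
      qed
    qed
  next
    case connected
    have bed: "bed E t S = 1 + Min ((\<lambda>T. bed E t (S - T)) ` {T. bed_root E t S T})"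
      by (subst bed.simps) (use connected fin in auto)
    have "graph_connected E S" using connected fin by (intro connected_if_few_components) auto
    moreover obtain v where "v \<in> S" using connected(1) by blast
    \<comment> \<open>A singleton root exists, so \<open>Min\<close> ranges over a nonempty set and
      some root attains it.\<close>
    ultimately have "bed_root E t S {v}" using assms(2) by (rule bed_root_singleton)
    then have "{T. bed_root E t S T} \<noteq> {}" by blast
    moreover have "finite {T. bed_root E t S T}"
      by (rule finite_subset[of _ "Pow S"]) (use fin in \<open>auto simp: bed_root_def\<close>)
    ultimately have "Min ((\<lambda>T. bed E t (S - T)) ` {T. bed_root E t S T})
        \<in> (\<lambda>T. bed E t (S - T)) ` {T. bed_root E t S T}"
      by (intro Min_in) auto
    then obtain T where root: "bed_root E t S T" and bed_T: "bed E t S = Suc (bed E t (S - T))"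
      using bed by auto
    have T: "T \<noteq> {}" "T \<subseteq> S" "t_cliques E t T = {}" using root by (auto simp: bed_root_def)
    obtain p :: "'a \<Rightarrow> 'a" where p: "inj_on p T"
      "\<forall>u\<in>S. \<forall>v\<in>S. {u, v} \<in> E \<longrightarrow> u \<in> T \<and> v \<in> T \<or> p u = p v"
      using ex_root_map[OF root] by blast
    have "hered_crit_bound E t (S - T) (beta (bed E t (S - T)) t)"
      using fin T by (intro IH psubset_card_mono) auto
    then have "hered_crit_bound E t S (2 ^ (t * beta (bed E t (S - T)) t))"
      using p(2) by (intro hered_crit_bound_root[OF fin assms(2) beta_ge_1 T(2,3) p(1)]) blast+
    then show ?thesis by (simp add: bed_T)
  qed
qed

subsection \<open>Minimal blocking sets\<close>

lemma opt_ext_le: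
  assumes "finite S" "hits E t S X" "\<forall>Z\<in>F. X \<inter> Z \<noteq> {}"
  shows "opt_ext E t S F \<le> card X"
  unfolding opt_ext_def using assms finite_card_Collect[of S]
  by (intro Min_le) (auto simp: hits_def)

lemma ex_opt_ext:
  assumes "finite S" "t \<ge> 1" "F \<subseteq> small_cliques E t S"
  shows "\<exists>X. hits E t S X \<and> (\<forall>Z\<in>F. X \<inter> Z \<noteq> {}) \<and> card X = opt_ext E t S F"
proof -
  let ?A = "{card X |X. X \<subseteq> S \<and> (\<forall>K\<in>t_cliques E t S. X \<inter> K \<noteq> {}) \<and> (\<forall>Z\<in>F. X \<inter> Z \<noteq> {})}"
  have "S \<inter> Z \<noteq> {}" if "Z \<in> F" for Z
    using small_cliquesD(1,2)[OF subsetD[OF assms(3) that]] by blast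
  then have "?A \<noteq> {}" using hits_self[OF assms(2), of E S] unfolding hits_def by blast
  moreover have "finite ?A" using assms(1) by (rule finite_card_Collect)
  ultimately have "opt_ext E t S F \<in> ?A" unfolding opt_ext_def by (intro Min_in)
  then obtain X where "opt_ext E t S F = card X"
    "X \<subseteq> S" "\<forall>K\<in>t_cliques E t S. X \<inter> K \<noteq> {}" "\<forall>Z\<in>F. X \<inter> Z \<noteq> {}"
    unfolding mem_Collect_eq by blast
  then show ?thesis by (intro exI[of _ X]) (simp add: hits_def)
qed

text \<open>
  Cleanness of \<open>F\<close> makes the blocking sets of \<open>F\<close> exactly the families \<open>B\<close> for which \<open>F \<union> B\<close> is
  unhittable by minimum hitting sets, so an unhittable subfamily of \<open>F \<union> B\<close> bounds \<open>B\<close>.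
\<close>

lemma card_minimal_blocking_set_le:
  assumes fin: "finite S" and t: "t \<ge> 1" and bound: "crit_bound E t S n"
    and F: "clean E t S F" and B: "minimal_blocking_set E t S F B"
  shows "card B \<le> n"
proof -
  have Fs: "F \<subseteq> small_cliques E t S" and opt: "opt_ext E t S F = opt E t S"
    using F by (auto simp: clean_def)
  have Bs: "B \<subseteq> small_cliques E t S" and gt: "opt_ext E t S F < opt_ext E t S (F \<union> B)"
    using B by (auto simp: minimal_blocking_set_def blocking_set_def)
  have "unhittable (min_hits E t S) (F \<union> B)"
  proof (rule ccontr)
    assume "\<not> ?thesis"
    then obtain X where X: "min_hits E t S X" "\<forall>Z\<in>F \<union> B. X \<inter> Z \<noteq> {}" by (rule not_unhittableE)
    then have "opt_ext E t S (F \<union> B) \<le> card X" using fin by (intro opt_ext_le min_hitsD)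
    then show False using gt opt min_hitsD(3)[OF X(1)] by simp
  qed
  then have "reducible (min_hits E t S) (F \<union> B) n" using bound Fs Bs by (intro crit_boundD) auto
  then obtain \<W> where W: "\<W> \<subseteq> F \<union> B" "card \<W> \<le> n" "unhittable (min_hits E t S) \<W>"
    unfolding reducible_def by blast
  \<comment> \<open>A minimum hitting set meeting all of \<open>F\<close> and of
    \<open>\<W> \<inter> B\<close> would meet all of \<open>\<W>\<close>, since members of
    \<open>\<W>\<close> outside \<open>B\<close> lie in \<open>F\<close>. Minimality of
    \<open>B\<close> then forces \<open>B \<subseteq> \<W>\<close>.\<close>
  have "blocking_set E t S F (\<W> \<inter> B)"
  proof (rule ccontr)
    assume nb: "\<not> blocking_set E t S F (\<W> \<inter> B)"
    have sub: "F \<union> (\<W> \<inter> B) \<subseteq> small_cliques E t S" using Fs Bs by blast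
    obtain X where X: "hits E t S X" "\<forall>Z\<in>F \<union> (\<W> \<inter> B). X \<inter> Z \<noteq> {}"
      "card X = opt_ext E t S (F \<union> (\<W> \<inter> B))"
      using ex_opt_ext[OF fin t sub] by blast
    have "card X \<le> opt E t S" using nb sub opt X(3) by (auto simp: blocking_set_def)
    with fin X(1) have "min_hits E t S X" by (rule min_hitsI)
    then obtain Z where "Z \<in> \<W>" "X \<inter> Z = {}" using unhittableD[OF W(3)] by blast
    then show False using X(2) W(1) by blast
  qed
  then have "\<not> \<W> \<inter> B \<subset> B" using B unfolding minimal_blocking_set_def by blast
  then have "B \<subseteq> \<W>" by blast
  moreover have "finite \<W>"
    using W(1) Fs Bs by (intro finite_subset[OF _ finite_small_cliques[OF fin]]) blast
  ultimately have "card B \<le> card \<W>" by (intro card_mono)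
  then show ?thesis using W(2) by simp
qed

theorem theorem9:
  fixes V :: "'a set" and E :: "'a set set" and t :: nat
  assumes "finite V" and "E \<subseteq> nsets V 2" and "t \<ge> 3"
  shows "mmbs E t V \<le> beta (bed E t V) t"
proof -
  have t: "t \<ge> 2" "t \<ge> 1" using assms(3) by auto
  have bound: "crit_bound E t V (beta (bed E t V) t)"
    using hered_crit_bound_beta[OF assms(1) t(1)] by (auto simp: hered_crit_bound_def)
  have fin: "finite (small_cliques E t V)" using assms(1) by (rule finite_small_cliques)
  have ext: "mmbs_ext E t V F \<le> beta (bed E t V) t" if F: "clean E t V F" for F
  proof -
    have "finite {card B |B. minimal_blocking_set E t V F B}"
      by (rule finite_subset[of _ "card ` Pow (small_cliques E t V)"])
        (use fin in \<open>auto simp: minimal_blocking_set_def blocking_set_def\<close>)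
    then show ?thesis
      unfolding mmbs_ext_def
      using card_minimal_blocking_set_le[OF assms(1) t(2) bound F] by auto
  qed
  have "finite {mmbs_ext E t V F |F. clean E t V F}"
    by (rule finite_subset[of _ "mmbs_ext E t V ` Pow (small_cliques E t V)"])
      (use fin in \<open>auto simp: clean_def\<close>)
  \<comment> \<open>The empty family is clean, which makes the outer \<open>Max\<close> range over a
    nonempty set.\<close>
  moreover have "clean E t V {}" by (simp add: clean_def opt_ext_def opt_def)
  ultimately show ?thesis
    unfolding mmbs_def using ext by (subst Max_le_iff) auto
qed

end
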